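(* Let $(m_t^{\mathrm{KBP}},P_t^{\mathrm{KBP}})$ be the solution of $$dm_t=(Am_t+f)dt+P_tH^\top\Gamma^{-1}(d\mathcal Z_t-Hm_tdt),\qquad \frac{d}{dt}P_t=AP_t+P_tA^\top-P_tSP_t+\Sigma,$$ and let $(m_t^{\mathrm{DLR}},P_t^{\mathrm{DLR}})$ be the solution of $$dm_t=(Am_t+f)dt+P_tH^\top\Gamma^{-1}(d\mathcal Z_t-Hm_tdt),\qquad \frac{d}{dt}P_t=AP_t+P_tA^\top-P_tSP_t+\Pi_{\boldsymbol U_t}\Sigma\,\Pi_{\boldsymbol U_t},$$ both driven by the same observation process $\mathcal Z$, where $\boldsymbol U_t$ solves $\frac{d}{dt}\boldsymbol U_t=\Pi^\perp_{\boldsymbol U_t}A\boldsymbol U_t$ with $\boldsymbol U_0\in\mathrm{St}(d,R)$. Set $\varepsilon_R(t)=\|\Pi^\perp_{\boldsymbol U_t}\Sigma^{1/2}\|_F$. Then, with constants $C_1(T),C_2(T)$, it holds $$\mathbb E\|m_T^{\mathrm{DLR}}-m_T^{\mathrm{KBP}}\|^2\le C_1(T)\Big(\mathbb E\|m_0^{\mathrm{DLR}}-m_0^{\mathrm{KBP}}\|^2+\|P_0^{\mathrm{KBP}}-P_0^{\mathrm{DLR}}\|_F^2+\sup_{0\le s\le T}\varepsilon_R^2(s)\Big),$$ $$\|P_T^{\mathrm{DLR}}-P_T^{\mathrm{KBP}}\|_F^2\le C_2(T)\Big(\|P_0^{\mathrm{DLR}}-P_0^{\mathrm{KBP}}\|_F^2+\sup_{0\le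 s\le T}\varepsilon_R^2(s)\Big).$$
   Context: Setting. Let $1\le R\le d$, $k\ge1$, $A\in\mathbb R^{d\times d}$, $f\in\mathbb R^d$, $\Sigma\in\mathbb R^{d\times d}$ symmetric positive semidefinite, $H\in\mathbb R^{k\times d}$, $\Gamma\in\mathbb R^{k\times k}$ symmetric positive definite, $S=H^\top\Gamma^{-1}H$. A continuous signal path $t\mapsto\mathcal X_t^{\mathrm{signal}}\in\mathbb R^d$ is fixed (a realisation of $d\mathcal X^{\mathrm{signal}}_t=(A\mathcal X^{\mathrm{signal}}_t+f)dt+\Sigma^{1/2}d\widetilde{\mathcal W}_t$, with $\widetilde{\mathcal W}$ a standard $d$-dimensional Brownian motion); the observation process is $\mathcal Z_0=0$, $d\mathcal Z_t=H\mathcal X_t^{\mathrm{signal}}dt+\Gamma^{1/2}d\widetilde{\mathcal V}_t$ with $\widetilde{\mathcal V}$ a standard $k$-dimensional Brownian motion. The expectation $\mathbb E$ is over all realisations of $\mathcal Z$ (conditional on the given signal path). $\mathrm{St}(d,R)=\{U\in\mathbb R^{d\times R}:U^\top U=I_R\}$; $\boldsymbol U_t\in\mathrm{St}(d,R)$ for all $t\ge0$; $\Pi_{\boldsymbol U}=\boldsymbol U\boldsymbol U^\top$, $\Pi^\perp_{\boldsymbol U}=I_d-\Pi_{\boldsymbol U}$. The pair $(m_t^{\mathrm{KBP}},P_t^{\mathrm{KBP}})$ is the mean and covariance of the Kalman-Bucy process; $(m_t^{\mathrm{DLR}},P_t^{\mathrm{DLR}})$ is the conditional mean and covariance of its rank-$R$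 dynamical low-rank approximation. Initial covariances are deterministic symmetric positive semidefinite, with $P_0^{\mathrm{DLR}}=\boldsymbol U_0M_0\boldsymbol U_0^\top$ for some symmetric positive semidefinite $M_0\in\mathbb R^{R\times R}$; initial means are square-integrable and independent of $\widetilde{\mathcal V}$. $\|\cdot\|_F$ is the Frobenius norm. *)

theory Defs
  imports "HOL-Probability.Probability"
begin

text \<open>A \<open>d \<times> R\<close> matrix is rendered as \<open>real ^ 'r ^ 'd\<close>. On these types the library's
  \<^const>\<open>norm\<close> (the Euclidean norm of the vector of row norms) is the Frobenius norm.\<close>

definition sym_psd :: "real ^ 'n ^ 'n \<Rightarrow> bool" where
  "sym_psd B \<longleftrightarrow> transpose B = B \<and> (\<forall>x. 0 \<le> x \<bullet> (B *v x))"

definition sym_pd :: "real ^ 'n ^ 'n \<Rightarrow> bool" where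
  "sym_pd B \<longleftrightarrow> transpose B = B \<and> (\<forall>x. x \<noteq> 0 \<longrightarrow> 0 < x \<bullet> (B *v x))"

text \<open>\<open>is_sqrt Q B\<close> says \<open>Q = B\<^sup>1\<^sup>/\<^sup>2\<close>: a positive semidefinite \<open>B\<close> has exactly one such \<open>Q\<close>.\<close>

definition is_sqrt :: "real ^ 'n ^ 'n \<Rightarrow> real ^ 'n ^ 'n \<Rightarrow> bool" where
  "is_sqrt Q B \<longleftrightarrow> sym_psd Q \<and> Q ** Q = B"

definition stiefel :: "(real ^ 'r ^ 'd) set" where
  "stiefel = {U. transpose U ** U = mat 1}"

definition proj :: "real ^ 'r ^ 'd \<Rightarrow> real ^ 'd ^ 'd" where
  "proj U = U ** transpose U"

definition proj_perp :: "real ^ 'r ^ 'd \<Rightarrow> real ^ 'd ^ 'd" where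
  "proj_perp U = mat 1 - proj U"

definition brownian_motion :: "'w measure \<Rightarrow> (real \<Rightarrow> 'w \<Rightarrow> real ^ 'k) \<Rightarrow> bool" where
  "brownian_motion M V \<longleftrightarrow>
     prob_space M \<and>
     (\<forall>t\<ge>0. V t \<in> borel_measurable M) \<and>
     (AE \<omega> in M. V 0 \<omega> = 0) \<and>
     (AE \<omega> in M. continuous_on {0..} (\<lambda>t. V t \<omega>)) \<and>
     (\<forall>(n::nat) (\<tau>::nat \<Rightarrow> real). 0 \<le> \<tau> 0 \<and> (\<forall>i<n. \<tau> i \<le> \<tau> (Suc i)) \<longrightarrow>
        prob_space.indep_vars M (\<lambda>_. borel) (\<lambda>i \<omega>. V (\<tau> (Suc i)) \<omega> - V (\<tau> i) \<omega>) {..<n}) \<and>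
     (\<forall>s t. 0 \<le> s \<and> s < t \<longrightarrow>
        prob_space.indep_vars M (\<lambda>_. borel) (\<lambda>j \<omega>. (V t \<omega> - V s \<omega>) $ j) UNIV \<and>
        (\<forall>j. distributed M lborel (\<lambda>\<omega>. (V t \<omega> - V s \<omega>) $ j)
               (\<lambda>x. ennreal (normal_density 0 (sqrt (t - s)) x))))"

text \<open>Independence of a random vector from the sigma-algebra generated by a whole process.\<close>

definition indep_of_process ::
  "'w measure \<Rightarrow> ('w \<Rightarrow> real ^ 'n) \<Rightarrow> (real \<Rightarrow> 'w \<Rightarrow> real ^ 'k) \<Rightarrow> bool" where
  "indep_of_process M Y V \<longleftrightarrow>
     prob_space.indep_set M
       (sets (vimage_algebra (space M) Y borel))
       (sets (vimage_algebra (space M) (\<lambda>\<omega>. \<lambda>t\<in>{0..}. V t \<omega>) (Pi\<^sub>M {0..} (\<lambda>_. borel))))"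

text \<open>The observation process \<open>dZ = H X dt + \<Gamma>\<^sup>1\<^sup>/\<^sup>2 dV\<close>, \<open>Z\<^sub>0 = 0\<close>, for a fixed signal
  path \<open>X\<close>; \<open>\<Gamma>h\<close> stands for \<open>\<Gamma>\<^sup>1\<^sup>/\<^sup>2\<close>.\<close>

definition observation ::
  "real ^ 'd ^ 'k \<Rightarrow> real ^ 'k ^ 'k \<Rightarrow> (real \<Rightarrow> real ^ 'd) \<Rightarrow> (real \<Rightarrow> 'w \<Rightarrow> real ^ 'k)
     \<Rightarrow> real \<Rightarrow> 'w \<Rightarrow> real ^ 'k" where
  "observation H \<Gamma>h X V t \<omega> = integral {0..t} (\<lambda>s. H *v X s) + \<Gamma>h *v V t \<omega>"

text \<open>\<open>ito_integral M G Z t I\<close> says that \<open>I\<close> is (a version of) the stochastic integral of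
  \<open>G\<close> against \<open>dZ\<close> over \<open>[0, t]\<close>. Only deterministic continuous integrands \<open>G\<close> are needed, for
  which the integral is the mean-square limit of the left-endpoint sums as the mesh of the
  partition tends to 0.\<close>

definition ito_integral ::
  "'w measure \<Rightarrow> (real \<Rightarrow> real ^ 'k ^ 'd) \<Rightarrow> (real \<Rightarrow> 'w \<Rightarrow> real ^ 'k) \<Rightarrow> real
     \<Rightarrow> ('w \<Rightarrow> real ^ 'd) \<Rightarrow> bool" where
  "ito_integral M G Z t I \<longleftrightarrow>
     I \<in> borel_measurable M \<and>
     (\<forall>e>0. \<exists>\<delta>>0. \<forall>(n::nat) (\<tau>::nat \<Rightarrow> real).
        \<tau> 0 = 0 \<and> \<tau> n = t \<and> (\<forall>i<n. \<tau> i \<le> \<tau> (Suc i) \<and> \<tau> (Suc i) - \<tau> i < \<delta>) \<longrightarrow>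
        (\<integral>\<^sup>+\<omega>. ennreal ((norm ((\<Sum>i<n. G (\<tau> i) *v (Z (\<tau> (Suc i)) \<omega> - Z (\<tau> i) \<omega>)) - I \<omega>))\<^sup>2) \<partial>M)
          < ennreal e)"

definition obs_info :: "real ^ 'd ^ 'k \<Rightarrow> real ^ 'k ^ 'k \<Rightarrow> real ^ 'd ^ 'd" where
  "obs_info H \<Gamma> = transpose H ** matrix_inv \<Gamma> ** H"

definition kalman_gain ::
  "real ^ 'd ^ 'k \<Rightarrow> real ^ 'k ^ 'k \<Rightarrow> real ^ 'd ^ 'd \<Rightarrow> real ^ 'k ^ 'd" where
  "kalman_gain H \<Gamma> P = P ** transpose H ** matrix_inv \<Gamma>"

text \<open>Strong solution, with a.s. continuous paths, of
  \<open>dm = (A m + f) dt + P H\<^sup>T \<Gamma>\<^sup>-\<^sup>1 (dZ - H m dt)\<close>.\<close>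

definition mean_solution ::
  "'w measure \<Rightarrow> real ^ 'd ^ 'd \<Rightarrow> real ^ 'd \<Rightarrow> real ^ 'd ^ 'k \<Rightarrow> real ^ 'k ^ 'k
     \<Rightarrow> (real \<Rightarrow> 'w \<Rightarrow> real ^ 'k) \<Rightarrow> (real \<Rightarrow> real ^ 'd ^ 'd) \<Rightarrow> (real \<Rightarrow> 'w \<Rightarrow> real ^ 'd) \<Rightarrow> bool" where
  "mean_solution M A f H \<Gamma> Z P m \<longleftrightarrow>
     (\<forall>t\<ge>0. m t \<in> borel_measurable M) \<and>
     (AE \<omega> in M. continuous_on {0..} (\<lambda>t. m t \<omega>)) \<and>
     (\<forall>t\<ge>0. \<exists>I. ito_integral M (\<lambda>s. kalman_gain H \<Gamma> (P s)) Z t I \<and>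
        (AE \<omega> in M. m t \<omega> = m 0 \<omega> +
           integral {0..t} (\<lambda>s. A *v m s \<omega> + f - kalman_gain H \<Gamma> (P s) *v (H *v m s \<omega>)) + I \<omega>))"

definition riccati_solution ::
  "real ^ 'd ^ 'd \<Rightarrow> real ^ 'd ^ 'd \<Rightarrow> (real \<Rightarrow> real ^ 'd ^ 'd) \<Rightarrow> (real \<Rightarrow> real ^ 'd ^ 'd) \<Rightarrow> bool" where
  "riccati_solution A S Q P \<longleftrightarrow>
     (\<forall>t\<ge>0. (P has_vector_derivative
        (A ** P t + P t ** transpose A - P t ** S ** P t + Q t)) (at t within {0..}))"

definition basis_solution ::
  "real ^ 'd ^ 'd \<Rightarrow> (real \<Rightarrow> real ^ 'r ^ 'd) \<Rightarrow> bool" where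
  "basis_solution A U \<longleftrightarrow>
     U 0 \<in> stiefel \<and>
     (\<forall>t\<ge>0. (U has_vector_derivative (proj_perp (U t) ** A ** U t)) (at t within {0..}))"

definition noise_defect :: "real ^ 'd ^ 'd \<Rightarrow> real ^ 'r ^ 'd \<Rightarrow> real" where
  "noise_defect \<Sigma>h U = norm (proj_perp U ** \<Sigma>h)"

end

theory Submission
  imports Defs
begin

text \<open>Both claims are stability estimates for an initial value problem, and the work lies in making the
constants depend on the two solutions only through the radius \<open>\<rho>\<close>.

For the covariances, the difference \<open>E = PD - PK\<close> satisfies
\<open>E' = A E + E A\<^sup>T - E S PD - PK S E + (\<Pi> \<Sigma> \<Pi> - \<Sigma>)\<close>, which is linear in \<open>E\<close>, with a forcing term of size
\<open>O(\<epsilon>\<^sub>R)\<close>: write \<open>\<Pi> \<Sigma> \<Pi> - \<Sigma>\<close> as \<open>- \<Pi>\<^sup>\<bottom> \<Sigma> - \<Pi> \<Sigma> \<Pi>\<^sup>\<bottom>\<close> and split one factor \<open>\<Sigma>\<^sup>1\<^sup>/\<^sup>2\<close> off (\<open>proj_noise_defect\<close>).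
Gronwall's inequality then gives the second claim (\<open>riccati_stability\<close>), once \<open>PK\<close> and \<open>PD\<close> are bounded
a priori. This bound uses positivity: a Riccati solution that starts symmetric positive semidefinite
stays so (\<open>riccati_sym_psd\<close>), hence its norm is controlled by its trace, and in the equation for the
trace the quadratic term has the good sign and can be dropped (\<open>riccati_norm_bound\<close>). That the forcing
\<open>\<Pi> \<Sigma> \<Pi>\<close> is bounded requires \<open>U\<^sub>t\<close> to stay orthonormal (\<open>basis_solution_stiefel\<close>).

For the means, the difference \<open>\<delta> = mD - mK\<close> satisfies
\<open>d\<delta> = (A - PD S) \<delta> dt - E S mK dt + E H\<^sup>T \<Gamma>\<^sup>-\<^sup>1 dZ\<close>. The stochastic integral has a second moment
of order \<open>sup \<parallel>E\<parallel>\<^sup>2\<close> (\<open>ito_integral_second_moment\<close>). Nothing is known in advance about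
the second moments of \<open>\<delta>\<close> and \<open>mK\<close> at positive times, so Gronwall's inequality cannot be applied to
the expectation of \<open>\<parallel>\<delta>\<^sub>t\<parallel>\<^sup>2\<close>. It is applied path by path instead, and the expectation is taken afterwards
(\<open>moment_gronwall\<close>). The quantity that makes one application enough is \<open>\<parallel>\<delta>\<parallel> + \<eta> \<parallel>mK\<parallel>\<close> with
\<open>\<eta> = sup \<parallel>E\<parallel>\<close>: the forcing \<open>E S mK\<close> is then absorbed into the linear growth term, and every term
that remains carries either \<open>\<delta>\<^sub>0\<close> or a factor \<open>\<eta>\<close> (\<open>mean_difference_growth\<close>,
\<open>mean_difference_second_moment\<close>). The first claim follows on inserting the second one for \<open>\<eta>\<^sup>2\<close>.\<close>

section \<open>Matrices with the Frobenius norm\<close>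

lemma norm_matrix_power2:
  fixes A :: "real ^ 'n ^ 'm"
  shows "(norm A)\<^sup>2 = (\<Sum>i\<in>UNIV. (norm (A $ i))\<^sup>2)"
  by (simp only: power2_norm_eq_inner inner_vec_def)

lemma norm_matrix_vector_mult_le:
  fixes A :: "real ^ 'n ^ 'm"
  shows "norm (A *v x) \<le> norm A * norm x"
proof -
  have "(norm (A *v x))\<^sup>2 = (\<Sum>i\<in>UNIV. (A $ i \<bullet> x)\<^sup>2)"
    unfolding power2_norm_eq_inner inner_vec_def matrix_vector_mult_def
    by (simp add: power2_eq_square)
  also have "\<dots> \<le> (\<Sum>i\<in>UNIV. (norm (A $ i))\<^sup>2 * (norm x)\<^sup>2)"
    by (intro sum_mono) (simp add: Cauchy_Schwarz_ineq power2_norm_eq_inner)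
  also have "\<dots> = (norm A * norm x)\<^sup>2"
    by (simp add: power_mult_distrib norm_matrix_power2 sum_distrib_right)
  finally show ?thesis by (rule power2_le_imp_le) simp
qed

lemma norm_transpose [simp]:
  fixes A :: "real ^ 'n ^ 'm"
  shows "norm (transpose A) = norm A"
proof -
  have "(norm (transpose A))\<^sup>2 = (norm A)\<^sup>2"
    unfolding power2_norm_eq_inner inner_vec_def transpose_def
    by (simp) (rule sum.swap)
  then show ?thesis by simp
qed

text \<open>Each row of \<open>A ** B\<close> is \<open>B\<^sup>T\<close> applied to the corresponding row of \<open>A\<close>.\<close>
lemma norm_matrix_matrix_mult_le:
  fixes A :: "real ^ 'n ^ 'm" and B :: "real ^ 'k ^ 'n"
  shows "norm (A ** B) \<le> norm A * norm B"
proof -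
  have row: "(A ** B) $ i = transpose B *v A $ i" for i
    by (simp add: matrix_matrix_mult_def matrix_vector_mult_def transpose_def vec_eq_iff mult.commute)
  have "(norm (A ** B))\<^sup>2 = (\<Sum>i\<in>UNIV. (norm (transpose B *v A $ i))\<^sup>2)"
    by (simp add: norm_matrix_power2 row)
  also have "\<dots> \<le> (\<Sum>i\<in>UNIV. (norm B * norm (A $ i))\<^sup>2)"
    by (intro sum_mono power_mono) (use norm_matrix_vector_mult_le[of "transpose B"] in auto)
  also have "\<dots> = (norm A * norm B)\<^sup>2"
    by (simp add: power_mult_distrib norm_matrix_power2[of A] sum_distrib_left mult.commute)
  finally show ?thesis by (rule power2_le_imp_le) simp
qed

lemma bounded_bilinear_matrix_matrix_mult:
  "bounded_bilinear ((**) :: real ^ 'n ^ 'm \<Rightarrow> real ^ 'k ^ 'n \<Rightarrow> real ^ 'k ^ 'm)"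
proof
  show "\<exists>K. \<forall>(A :: real ^ 'n ^ 'm) (B :: real ^ 'k ^ 'n). norm (A ** B) \<le> norm A * norm B * K"
    by (rule exI[of _ 1]) (simp add: norm_matrix_matrix_mult_le)
qed (simp_all add: matrix_add_ldistrib matrix_matrix_mult_def vec_eq_iff sum.distrib
       distrib_left distrib_right sum_distrib_left mult_ac)

lemma bounded_bilinear_matrix_vector_mult:
  "bounded_bilinear ((*v) :: real ^ 'n ^ 'm \<Rightarrow> real ^ 'n \<Rightarrow> real ^ 'm)"
proof
  show "\<exists>K. \<forall>(A :: real ^ 'n ^ 'm) x. norm (A *v x) \<le> norm A * norm x * K"
    by (rule exI[of _ 1]) (simp add: norm_matrix_vector_mult_le)
qed (simp_all add: matrix_vector_mult_def vec_eq_iff sum.distrib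
       distrib_left distrib_right sum_distrib_left mult_ac)

lemma bounded_linear_transpose:
  "bounded_linear (transpose :: real ^ 'n ^ 'm \<Rightarrow> real ^ 'm ^ 'n)"
  by (rule bounded_linear_intro[of _ 1]) (simp_all add: transpose_def vec_eq_iff, simp flip: transpose_def)

lemmas continuous_on_matrix_matrix_mult =
  bounded_bilinear.continuous_on[OF bounded_bilinear_matrix_matrix_mult]
lemmas continuous_on_matrix_vector_mult =
  bounded_bilinear.continuous_on[OF bounded_bilinear_matrix_vector_mult]
lemmas matrix_mult_diff_left =
  bounded_bilinear.diff_left[OF bounded_bilinear_matrix_matrix_mult]
lemmas matrix_mult_diff_right =
  bounded_bilinear.diff_right[OF bounded_bilinear_matrix_matrix_mult]
lemmas matrix_mult_minus_left =
  bounded_bilinear.minus_left[OF bounded_bilinear_matrix_matrix_mult]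
lemmas transpose_diff = linear_diff[OF bounded_linear.linear, OF bounded_linear_transpose]
lemmas transpose_add = linear_add[OF bounded_linear.linear, OF bounded_linear_transpose]

lemma inner_matrix_transpose: "x \<bullet> (A *v y) = (transpose A *v x) \<bullet> y"
  for A :: "real ^ 'n ^ 'm"
  by (simp add: dot_lmul_matrix transpose_matrix_vector)

lemma sym_psdD:
  assumes "sym_psd B"
  shows "transpose B = B" "0 \<le> x \<bullet> (B *v x)"
  using assms by (auto simp: sym_psd_def)

lemma inner_axis_matrix_axis: "axis i 1 \<bullet> (B *v axis j 1) = B $ i $ j"
  for B :: "real ^ 'n ^ 'm"
  by (simp add: inner_axis' matrix_vector_mult_basis column_def)

text \<open>Testing positivity on \<open>e\<^sub>i \<plusminus> e\<^sub>j\<close> bounds every entry by the mean of two diagonal entries. The constant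
is not sharp.\<close>
lemma sym_psd_norm_le_trace:
  fixes P :: "real ^ 'n ^ 'n"
  assumes "sym_psd P"
  shows "norm P \<le> real CARD('n) * trace P"
proof -
  have sym: "P $ i $ j = P $ j $ i" for i j
    using sym_psdD(1)[OF assms] by (metis transpose_def vec_lambda_beta)
  have entry: "\<bar>P $ i $ j\<bar> \<le> (P $ i $ i + P $ j $ j) / 2" for i j
  proof -
    have "0 \<le> (axis i 1 + axis j 1) \<bullet> (P *v (axis i 1 + axis j 1))"
      "0 \<le> (axis i 1 - axis j 1) \<bullet> (P *v (axis i 1 - axis j 1))"
      by (rule sym_psdD(2)[OF assms])+
    then show ?thesis
      by (simp add: inner_add_left inner_add_right inner_diff_left inner_diff_right
          matrix_vector_right_distrib matrix_vector_mult_diff_distrib inner_axis_matrix_axis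
          sym[of j i])
  qed
  have "norm P \<le> (\<Sum>i\<in>UNIV. norm (P $ i))" by (simp add: norm_vec_def L2_set_le_sum)
  also have "\<dots> \<le> (\<Sum>i\<in>UNIV. \<Sum>j\<in>UNIV. \<bar>P $ i $ j\<bar>)" by (intro sum_mono norm_le_l1_cart)
  also have "\<dots> \<le> (\<Sum>i\<in>UNIV. \<Sum>j\<in>UNIV. (P $ i $ i + P $ j $ j) / 2)"
    by (intro sum_mono entry)
  also have "\<dots> = real CARD('n) * trace P"
    by (simp add: sum.distrib trace_def add_divide_distrib sum_distrib_left flip: sum_divide_distrib)
  finally show ?thesis .
qed

lemma trace_sym_psd_nonneg: "sym_psd P \<Longrightarrow> 0 \<le> trace P"
  unfolding trace_def inner_axis_matrix_axis[symmetric] by (intro sum_nonneg sym_psdD(2))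

lemma trace_le_norm: "\<bar>trace P\<bar> \<le> real CARD('n) * norm P" for P :: "real ^ 'n ^ 'n"
proof -
  have "\<bar>trace P\<bar> \<le> (\<Sum>i\<in>UNIV. \<bar>P $ i $ i\<bar>)" unfolding trace_def by (rule sum_abs)
  also have "\<dots> \<le> (\<Sum>i\<in>(UNIV::'n set). norm P)"
    by (intro sum_mono) (metis component_le_norm_cart Finite_Cartesian_Product.norm_nth_le order_trans)
  finally show ?thesis by simp
qed

lemma trace_transpose [simp]: "trace (transpose P) = trace P" 
  by (simp add: trace_def transpose_def)

lemma bounded_linear_trace: "bounded_linear (trace :: real ^ 'n ^ 'n \<Rightarrow> real)"
proof (rule bounded_linear_intro[of _ "real CARD('n)"])
  show "trace (P + Q) = trace P + trace Q" for P Q :: "real ^ 'n ^ 'n" by (rule trace_add)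
  show "trace (r *\<^sub>R P) = r *\<^sub>R trace P" for r and P :: "real ^ 'n ^ 'n"
    by (simp add: trace_def sum_distrib_left)
  show "norm (trace P) \<le> norm P * real CARD('n)" for P :: "real ^ 'n ^ 'n"
    using trace_le_norm[of P] by (simp add: mult.commute)
qed

lemma sym_psd_congruence:
  fixes B :: "real ^ 'n ^ 'n" and C :: "real ^ 'n ^ 'm"
  assumes "sym_psd B"
  shows "sym_psd (C ** B ** transpose C)"
proof -
  have "x \<bullet> ((C ** B ** transpose C) *v x) = (transpose C *v x) \<bullet> (B *v (transpose C *v x))" for x
    by (simp add: inner_matrix_transpose flip: matrix_vector_mul_assoc)
  then show ?thesis
    using sym_psdD[OF assms] by (simp add: sym_psd_def matrix_transpose_mul matrix_mul_assoc)
qed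

lemma sym_pd_inverse:
  fixes \<Gamma> :: "real ^ 'k ^ 'k"
  assumes "sym_pd \<Gamma>"
  shows "\<Gamma> ** matrix_inv \<Gamma> = mat 1" "sym_psd (matrix_inv \<Gamma>)"
proof -
  have "inj ((*v) \<Gamma>)"
  proof (rule injI)
    fix x y assume "\<Gamma> *v x = \<Gamma> *v y"
    then have "\<Gamma> *v (x - y) = 0" by (simp add: matrix_vector_mult_diff_distrib)
    then show "x = y" using assms unfolding sym_pd_def by (metis inner_zero_right less_irrefl right_minus_eq)
  qed
  then have inv: "invertible \<Gamma>" by (simp add: invertible_left_inverse matrix_left_invertible_injective)
  then have *: "\<Gamma> ** matrix_inv \<Gamma> = mat 1 \<and> matrix_inv \<Gamma> ** \<Gamma> = mat 1"
    unfolding invertible_def matrix_inv_def by (rule someI_ex)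
  show r: "\<Gamma> ** matrix_inv \<Gamma> = mat 1" using * by simp
  have t: "transpose (matrix_inv \<Gamma>) ** \<Gamma> = mat 1"
    using arg_cong[OF r, of transpose] assms by (simp add: matrix_transpose_mul sym_pd_def)
  have sym: "transpose (matrix_inv \<Gamma>) = matrix_inv \<Gamma>"
    using t r by (metis matrix_mul_assoc matrix_mul_lid matrix_mul_rid)
  have "0 \<le> x \<bullet> (matrix_inv \<Gamma> *v x)" for x
  proof -
    let ?z = "matrix_inv \<Gamma> *v x"
    have "\<Gamma> *v ?z = x" by (simp add: matrix_vector_mul_assoc r)
    then have "x \<bullet> ?z = ?z \<bullet> (\<Gamma> *v ?z)" by (simp add: inner_commute)
    also have "\<dots> \<ge> 0" using assms by (cases "?z = 0") (auto simp: sym_pd_def less_imp_le)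
    finally show ?thesis by simp
  qed
  then show "sym_psd (matrix_inv \<Gamma>)" using sym by (simp add: sym_psd_def)
qed

lemma sym_psd_obs_info: "sym_pd \<Gamma> \<Longrightarrow> sym_psd (obs_info H \<Gamma>)"
  using sym_psd_congruence[OF sym_pd_inverse(2), of \<Gamma> "transpose H"] by (simp add: obs_info_def)

lemma kalman_gain_mult: "kalman_gain H \<Gamma> P *v (H *v x) = (P ** obs_info H \<Gamma>) *v x"
  by (simp add: kalman_gain_def obs_info_def matrix_vector_mul_assoc matrix_mul_assoc)

section \<open>Gronwall's inequality\<close>

text \<open>The function \<open>\<integral>\<^sub>0\<^sup>s a - e\<^sup>-\<^sup>b\<^sup>s u(s)\<close> is nondecreasing. Nonnegativity of \<open>a\<close> allows its
exponential weight to be replaced by \<open>1\<close>; the sign of \<open>u\<close> is arbitrary.\<close>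
lemma gronwall:
  fixes u a :: "real \<Rightarrow> real"
  assumes deriv: "\<And>s. s \<in> {0..T} \<Longrightarrow> (u has_vector_derivative u' s) (at s within {0..T})"
    and growth: "\<And>s. s \<in> {0..T} \<Longrightarrow> u' s \<le> b * u s + a s"
    and cont: "continuous_on {0..T} a" and nonneg: "\<And>s. s \<in> {0..T} \<Longrightarrow> 0 \<le> a s"
    and "0 \<le> b" "0 \<le> T"
  shows "u T \<le> exp (b * T) * (u 0 + integral {0..T} a)"
proof (cases "T = 0")
  case False
  define w where "w s = integral {0..s} a - exp (- (b * s)) * u s" for s
  define w' where "w' s = a s - (exp (- (b * s)) * u' s - b * exp (- (b * s)) * u s)" for s
  have w: "(w has_vector_derivative w' s) (at s within {0..T})" if "s \<in> {0..T}" for s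
  proof -
    have "((\<lambda>s. exp (- (b * s))) has_real_derivative - b * exp (- (b * s))) (at s within {0..T})"
      by (auto intro!: derivative_eq_intros)
    then have "((\<lambda>s. exp (- (b * s)) * u s) has_vector_derivative
        exp (- (b * s)) * u' s + - b * exp (- (b * s)) * u s) (at s within {0..T})"
      by (intro bounded_bilinear.has_vector_derivative[OF bounded_bilinear_mult] deriv that)
        (simp add: has_real_derivative_iff_has_vector_derivative)
    from has_vector_derivative_diff[OF integral_has_vector_derivative[OF cont that] this]
    show ?thesis by (simp add: w_def[abs_def] w'_def)
  qed
  have "\<exists>s\<in>{0<..<T}. w T - w 0 = w' s * (T - 0)"
    using mvt_simple[of 0 T w "\<lambda>s h. h * w' s"] w False \<open>0 \<le> T\<close>
    by (auto simp: has_vector_derivative_def mult.commute)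
  then obtain s where s: "s \<in> {0<..<T}" "w T - w 0 = w' s * T" by auto
  have "exp (- (b * s)) * (u' s - b * u s) \<le> exp (- (b * s)) * a s"
    using growth[of s] s(1) by (intro mult_left_mono) auto
  also have "\<dots> \<le> 1 * a s"
    using nonneg[of s] s(1) \<open>0 \<le> b\<close> by (intro mult_right_mono) auto
  finally have "0 \<le> w' s" by (simp add: w'_def algebra_simps)
  then have "w 0 \<le> w T" using s \<open>0 \<le> T\<close> by (metis diff_ge_0_iff_ge mult_nonneg_nonneg)
  then have "exp (- (b * T)) * u T \<le> u 0 + integral {0..T} a" by (simp add: w_def)
  then show ?thesis by (simp add: exp_minus divide_simps mult.commute)
qed simp

text \<open>The growth hypothesis is turned into a linear differential inequality for \<open>\<parallel>y\<parallel>\<^sup>2\<close>, which is differentiable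
even where \<open>y\<close> vanishes; the price is the additional \<open>1\<close> in the exponent.\<close>
lemma gronwall_norm:
  fixes y :: "real \<Rightarrow> 'a::real_inner"
  assumes deriv: "\<And>s. s \<in> {0..T} \<Longrightarrow> (y has_vector_derivative y' s) (at s within {0..T})"
    and growth: "\<And>s. s \<in> {0..T} \<Longrightarrow> norm (y' s) \<le> L * norm (y s) + c"
    and "0 \<le> L" "0 \<le> T"
  shows "(norm (y T))\<^sup>2 \<le> exp ((2 * L + 1) * T) * ((norm (y 0))\<^sup>2 + T * c\<^sup>2)"
proof -
  have "y T \<bullet> y T \<le> exp ((2 * L + 1) * T) * (y 0 \<bullet> y 0 + integral {0..T} (\<lambda>_. c\<^sup>2))"
  proof (rule gronwall[where u' = "\<lambda>s. 2 * (y s \<bullet> y' s)"])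
    show "((\<lambda>s. y s \<bullet> y s) has_vector_derivative 2 * (y s \<bullet> y' s)) (at s within {0..T})"
      if "s \<in> {0..T}" for s
      using bounded_bilinear.has_vector_derivative[OF bounded_bilinear_inner deriv[OF that] deriv[OF that]]
      by (simp add: inner_commute)
    show "2 * (y s \<bullet> y' s) \<le> (2 * L + 1) * (y s \<bullet> y s) + c\<^sup>2" if "s \<in> {0..T}" for s
    proof -
      have "y s \<bullet> y' s \<le> norm (y s) * norm (y' s)" by (rule norm_cauchy_schwarz)
      also have "\<dots> \<le> norm (y s) * (L * norm (y s) + c)"
        by (intro mult_left_mono growth that) simp
      finally have "2 * (y s \<bullet> y' s) \<le> 2 * L * (norm (y s))\<^sup>2 + 2 * norm (y s) * c"
        by (simp add: algebra_simps power2_eq_square)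
      also have "2 * norm (y s) * c \<le> (norm (y s))\<^sup>2 + c\<^sup>2"
        by (rule sum_squares_bound)
      finally show ?thesis by (simp add: power2_norm_eq_inner algebra_simps)
    qed
  qed (use assms in auto)
  then show ?thesis using \<open>0 \<le> T\<close> by (simp add: power2_norm_eq_inner)
qed

text \<open>The differential inequality holds for the primitive of \<open>y\<close>, so \<open>y\<close> itself need only be continuous. This is what
makes the inequality applicable to paths of diffusions.\<close>
lemma integral_gronwall:
  fixes y a :: "real \<Rightarrow> real"
  assumes y: "continuous_on {0..T} y" and a: "continuous_on {0..T} a" 
    and nonneg: "\<And>s. s \<in> {0..T} \<Longrightarrow> 0 \<le> a s"
    and le: "\<And>s. s \<in> {0..T} \<Longrightarrow> y s \<le> a s + b * integral {0..s} y"
    and "0 \<le> b" "0 \<le> T"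
  shows "y T \<le> a T + b * exp (b * T) * integral {0..T} a"
proof -
  have "integral {0..T} y \<le> exp (b * T) * (integral {0..0} y + integral {0..T} a)"
    using integral_has_vector_derivative[OF y] le a nonneg \<open>0 \<le> b\<close> \<open>0 \<le> T\<close>
    by (intro gronwall[where u' = y]) (auto simp: add.commute)
  then have "b * integral {0..T} y \<le> b * (exp (b * T) * integral {0..T} a)"
    using \<open>0 \<le> b\<close> by (intro mult_left_mono) auto
  then show ?thesis using le[of T] \<open>0 \<le> T\<close> by (simp add: algebra_simps)
qed

lemma compact_interval_norm_bound:
  fixes g :: "real \<Rightarrow> 'a::real_normed_vector"
  assumes "continuous_on {0..T} g"
  obtains B where "0 \<le> B" "\<And>t. t \<in> {0..T} \<Longrightarrow> norm (g t) \<le> B"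
proof -
  have "bounded (g ` {0..T})" using assms by (intro compact_imp_bounded compact_continuous_image) auto
  then obtain B where "\<forall>t\<in>{0..T}. norm (g t) \<le> B" by (auto simp: bounded_iff)
  then show ?thesis by (intro that[of "max B 0"]) (auto simp: max.coboundedI1)
qed

section \<open>The low-rank basis stays on the Stiefel manifold\<close>

lemma transpose_proj_perp [simp]: "transpose (proj_perp U) = proj_perp U"
  by (simp add: proj_perp_def proj_def transpose_diff matrix_transpose_mul transpose_mat)

lemma transpose_proj [simp]: "transpose (proj U) = proj U"
  by (simp add: proj_def matrix_transpose_mul)

text \<open>The orthonormality defect \<open>N = U\<^sup>T U - I\<close> satisfies \<open>N' = - W\<^sup>T N - N W\<close> with \<open>W = U\<^sup>T A U\<close>, because
\<open>U\<^sup>T (I - U U\<^sup>T) = - N U\<^sup>T\<close> holds for every \<open>U\<close>. This equation is linear and \<open>N\<close> starts at \<open>0\<close>.\<close>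
lemma basis_solution_stiefel:
  fixes U :: "real \<Rightarrow> real ^ 'r ^ 'd"
  assumes U: "basis_solution A U" and "0 \<le> T"
  shows "U T \<in> stiefel"
proof -
  define N where "N t = transpose (U t) ** U t - mat 1" for t
  define W where "W t = transpose (U t) ** A ** U t" for t
  have dU: "(U has_vector_derivative (proj_perp (U t) ** A ** U t)) (at t within {0..T})"
    if "t \<in> {0..T}" for t
    using U that unfolding basis_solution_def
    by (auto intro: has_vector_derivative_within_subset)
  have dN: "(N has_vector_derivative - (transpose (W t) ** N t + N t ** W t)) (at t within {0..T})"
    if t: "t \<in> {0..T}" for t
  proof -
    have perp: "transpose (U t) ** proj_perp (U t) = - (N t ** transpose (U t))"
      by (simp add: proj_perp_def proj_def N_def matrix_mult_diff_right matrix_mult_diff_left matrix_mul_assoc)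
    have "(N has_vector_derivative
       (transpose (U t) ** (proj_perp (U t) ** A ** U t) + 
        transpose (proj_perp (U t) ** A ** U t) ** U t) - 0) (at t within {0..T})"
      unfolding N_def
      by (intro has_vector_derivative_diff has_vector_derivative_const
        bounded_bilinear.has_vector_derivative[OF bounded_bilinear_matrix_matrix_mult]
        bounded_linear.has_vector_derivative[OF bounded_linear_transpose] dU t)
    moreover have "transpose (U t) ** (proj_perp (U t) ** A ** U t) = - (N t ** W t)"
      by (simp add: matrix_mul_assoc perp W_def matrix_mult_minus_left)
    moreover have "transpose (proj_perp (U t) ** A ** U t) ** U t = 
       transpose (transpose (U t) ** (proj_perp (U t) ** A ** U t))"
      by (simp add: matrix_transpose_mul)
    moreover have "transpose (N t) = N t"
      by (simp add: N_def transpose_diff matrix_transpose_mul transpose_mat)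
    ultimately show ?thesis
      by (simp add: matrix_transpose_mul linear_neg[OF bounded_linear.linear[OF bounded_linear_transpose]])
  qed
  have cU: "continuous_on {0..T} U"
    using dU by (rule continuous_on_vector_derivative)
  have "continuous_on {0..T} W"
    unfolding W_def
    by (intro continuous_on_matrix_matrix_mult continuous_on_const cU
       bounded_linear.continuous_on[OF bounded_linear_transpose])
  then obtain L where "0 \<le> L" and L: "\<And>t. t \<in> {0..T} \<Longrightarrow> norm (W t) \<le> L"
    by (rule compact_interval_norm_bound) blast
  have "norm (- (transpose (W t) ** N t + N t ** W t)) \<le> (2 * L) * norm (N t) + 0"
    if "t \<in> {0..T}" for t
  proof -
    have "norm (transpose (W t) ** N t + N t ** W t) \<le> norm (transpose (W t) ** N t) + norm (N t ** W t)"
      by (rule norm_triangle_ineq)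
    also have "\<dots> \<le> norm (W t) * norm (N t) + norm (N t) * norm (W t)"
      using norm_matrix_matrix_mult_le[of "transpose (W t)" "N t"]
      by (intro add_mono norm_matrix_matrix_mult_le) simp
    also have "\<dots> \<le> L * norm (N t) + norm (N t) * L"
      by (intro add_mono mult_mono L that) (use \<open>0 \<le> L\<close> in auto)
    finally show ?thesis unfolding norm_minus_cancel by simp
  qed
  from gronwall_norm[OF dN this] have "(norm (N T))\<^sup>2 \<le> exp ((2 * (2 * L) + 1) * T) * (norm (N 0))\<^sup>2"
    using \<open>0 \<le> L\<close> \<open>0 \<le> T\<close> by simp
  moreover have "N 0 = 0" using U by (simp add: N_def basis_solution_def stiefel_def)
  ultimately show ?thesis by (simp add: N_def stiefel_def)
qed

text \<open>A crude bound by \<open>\<parallel>U\<parallel>\<^sup>2 = tr (U\<^sup>T U) = R\<close>.\<close>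
lemma norm_proj_stiefel:
  fixes U :: "real ^ 'r ^ 'd"
  assumes "U \<in> stiefel"
  shows "norm (proj U) \<le> real CARD('r)"
proof -
  have "(norm U)\<^sup>2 = trace (transpose U ** U)"
    unfolding power2_norm_eq_inner inner_vec_def trace_def matrix_matrix_mult_def transpose_def
    by (simp) (rule sum.swap)
  also have "\<dots> = real CARD('r)" using assms by (simp add: stiefel_def trace_I)
  finally have "(norm U)\<^sup>2 = real CARD('r)" .
  moreover have "norm (proj U) \<le> norm U * norm U"
    unfolding proj_def using norm_matrix_matrix_mult_le[of U "transpose U"] by simp
  ultimately show ?thesis by (simp add: power2_eq_square)
qed

section \<open>The Riccati equation\<close>

text \<open>Along the line through \<open>x\<close> in direction \<open>v = B x\<close> the quadratic form vanishes at \<open>x\<close> with slope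
\<open>2 \<parallel>v\<parallel>\<^sup>2\<close>, so it takes negative values unless \<open>v = 0\<close>.\<close>
lemma sym_psd_null_vector:
  fixes B :: "real ^ 'n ^ 'n"
  assumes "sym_psd B" and x: "x \<bullet> (B *v x) \<le> 0"
  shows "B *v x = 0"
proof (rule ccontr)
  define v where "v = B *v x"
  define c where "c = v \<bullet> (B *v v)"
  \<comment> \<open>The shift \<open>1\<close> allows \<open>c = 0\<close>; \<open>s\<close> is small enough for the quadratic term \<open>s\<^sup>2 c\<close> to lose against the linear one.\<close>
  define s where "s = - (v \<bullet> v) / (c + 1)"
  assume "B *v x \<noteq> 0"
  then have v: "0 < v \<bullet> v" by (simp add: v_def)
  have c: "0 \<le> c" unfolding c_def by (rule sym_psdD(2)[OF assms(1)])
  have sym: "x \<bullet> (B *v v) = v \<bullet> v"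
    using sym_psdD(1)[OF assms(1)] by (simp add: inner_matrix_transpose v_def)
  have "0 \<le> (x + s *\<^sub>R v) \<bullet> (B *v (x + s *\<^sub>R v))" by (rule sym_psdD(2)[OF assms(1)])
  also have "\<dots> = x \<bullet> (B *v x) + 2 * s * (v \<bullet> v) + s\<^sup>2 * c"
    by (simp add: matrix_vector_right_distrib matrix_vector_mult_scaleR inner_add_left
        inner_add_right sym c_def power2_eq_square distrib_left flip: v_def)
  also have "\<dots> \<le> s * (2 * (v \<bullet> v) + s * c)" using x by (simp add: power2_eq_square ring_distribs)
  also have "\<dots> < 0"
  proof (rule mult_neg_pos)
    show "s < 0" using v c by (simp add: s_def divide_neg_pos)
    have "(v \<bullet> v) * c / (c + 1) \<le> v \<bullet> v" using v c by (simp add: divide_simps)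
    then show "0 < 2 * (v \<bullet> v) + s * c" using v unfolding s_def by (simp only: times_divide_eq_left mult_minus_left minus_divide_left[symmetric])
  qed
  finally show False by simp
qed

text \<open>A first-exit argument. At the first time at which the quadratic form of \<open>P\<close> vanishes on some unit vector \<open>e\<close>,
the matrix is still positive semidefinite, so \<open>e\<close> is a null vector. The form of \<open>e\<close> has then decreased to \<open>0\<close>
from positive values, which contradicts its positive derivative there.\<close>
lemma path_stays_positive_definite:
  fixes P :: "real \<Rightarrow> real ^ 'n ^ 'n"
  assumes deriv: "\<And>t. t \<in> {0..T} \<Longrightarrow> (P has_vector_derivative P' t) (at t within {0..T})"
    and sym: "\<And>t. t \<in> {0..T} \<Longrightarrow> transpose (P t) = P t"
    and init: "\<And>x. x \<noteq> 0 \<Longrightarrow> 0 < x \<bullet> (P 0 *v x)"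
    and inward: "\<And>t x. t \<in> {0..T} \<Longrightarrow> x \<noteq> 0 \<Longrightarrow> P t *v x = 0 \<Longrightarrow> 0 < x \<bullet> (P' t *v x)"
    and t: "t \<in> {0..T}" and "x \<noteq> 0"
  shows "0 < x \<bullet> (P t *v x)"
proof (rule ccontr)
  assume neg: "\<not> 0 < x \<bullet> (P t *v x)"
  define q where "q z = snd z \<bullet> (P (fst z) *v snd z)" for z :: "real \<times> (real ^ 'n)"
  \<comment> \<open>\<open>Z\<close> is compact, so its projection to the time axis has a least element, the first exit time.\<close>
  define Z where "Z = {z \<in> {0..T} \<times> sphere 0 1. q z \<le> 0}"
  have cP: "continuous_on {0..T} P" using deriv by (rule continuous_on_vector_derivative)
  have cq: "continuous_on ({0..T} \<times> sphere 0 1) q"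
    unfolding q_def
    by (intro continuous_intros continuous_on_matrix_vector_mult continuous_on_compose2[OF cP]) auto
  have "closed Z" unfolding Z_def
    by (intro continuous_on_closed_Collect_le cq continuous_on_const closed_Times) auto
  moreover have "compact ({0..T} \<times> sphere (0::real^'n) 1)" by (intro compact_Times) auto
  moreover have "Z = ({0..T} \<times> sphere 0 1) \<inter> Z" by (auto simp: Z_def)
  ultimately have "compact Z" by (metis compact_Int_closed)
  then have cpt: "compact (fst ` Z)" by (intro compact_continuous_image continuous_intros)
  define n where "n = x /\<^sub>R norm x"
  have "(t, n) \<in> Z" using t \<open>x \<noteq> 0\<close> neg
    by (auto simp: Z_def q_def n_def matrix_vector_mult_scaleR mult_nonneg_nonpos zero_le_mult_iff
        mult_le_0_iff)
  then have "fst ` Z \<noteq> {}" by auto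
  from compact_attains_inf[OF cpt this] obtain t0 where
    t0: "t0 \<in> fst ` Z" and first: "\<And>r. r \<in> fst ` Z \<Longrightarrow> t0 \<le> r" by auto
  from t0 obtain e where e: "norm e = 1" "e \<bullet> (P t0 *v e) \<le> 0" and t0T: "t0 \<in> {0..T}"
    by (auto simp: Z_def q_def)
  have "e \<noteq> 0" using e by auto
  have "t0 \<noteq> 0" using init[OF \<open>e \<noteq> 0\<close>] e by auto
  then have "0 < t0" using t0T by auto
  have before: "0 < y \<bullet> (P r *v y)" if r: "0 \<le> r" "r < t0" and "norm y = 1" for r y
  proof (rule ccontr)
    assume "\<not> 0 < y \<bullet> (P r *v y)"
    then have "(r, y) \<in> Z" using that t0T by (auto simp: Z_def q_def)
    then have "r \<in> fst ` Z" by force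
    from first[OF this] r show False by simp
  qed
  have dq: "((\<lambda>r. y \<bullet> (P r *v y)) has_real_derivative y \<bullet> (P' t0 *v y)) (at t0 within {0..T})" for y
    using bounded_linear.has_vector_derivative[OF bounded_linear_compose[OF bounded_linear_inner_right
      bounded_bilinear.bounded_linear_left[OF bounded_bilinear_matrix_vector_mult]] deriv[OF t0T], of y y]
    by (simp add: has_real_derivative_iff_has_vector_derivative)
  \<comment> \<open>Positivity before \<open>t0\<close> passes to the limit from the left.\<close>
  have unit: "0 \<le> y \<bullet> (P t0 *v y)" if "norm y = 1" for y
  proof (rule tendsto_lowerbound)
    have "((\<lambda>r. y \<bullet> (P r *v y)) \<longlongrightarrow> y \<bullet> (P t0 *v y)) (at t0 within {0..T})"
      using DERIV_continuous[OF dq] by (simp add: continuous_within)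
    then show "((\<lambda>r. y \<bullet> (P r *v y)) \<longlongrightarrow> y \<bullet> (P t0 *v y)) (at t0 within {0..<t0})"
      by (rule tendsto_within_subset) (use t0T in auto)
    show "\<forall>\<^sub>F r in at t0 within {0..<t0}. 0 \<le> y \<bullet> (P r *v y)"
      using before[OF _ _ that] by (auto simp: eventually_at_filter less_imp_le)
    show "at t0 within {0..<t0} \<noteq> bot"
      using \<open>0 < t0\<close> by (simp add: trivial_limit_within islimpt_in_closure)
  qed
  have "0 \<le> y \<bullet> (P t0 *v y)" for y
  proof (cases "y = 0")
    case False
    have "0 \<le> (y /\<^sub>R norm y) \<bullet> (P t0 *v (y /\<^sub>R norm y))" by (rule unit) (use False in simp)
    also have "\<dots> = (y \<bullet> (P t0 *v y)) / (norm y)\<^sup>2"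
      by (simp add: matrix_vector_mult_scaleR divide_inverse power2_eq_square)
    finally show ?thesis using False by (simp add: zero_le_divide_iff)
  qed simp
  then have "sym_psd (P t0)" using sym[OF t0T] by (simp add: sym_psd_def)
  then have "P t0 *v e = 0" using e(2) by (rule sym_psd_null_vector)
  from inward[OF t0T \<open>e \<noteq> 0\<close> this] have "0 < e \<bullet> (P' t0 *v e)" .
  from has_real_derivative_pos_inc_left[OF dq this] obtain d where d: "d > 0"
    "\<And>h. 0 < h \<Longrightarrow> t0 - h \<in> {0..T} \<Longrightarrow> h < d \<Longrightarrow> e \<bullet> (P (t0 - h) *v e) < e \<bullet> (P t0 *v e)" by blast
  define h where "h = min d t0 / 2"
  have h: "0 < h" "h < d" "h < t0" using \<open>0 < t0\<close> d(1) by (auto simp: h_def)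
  have "e \<bullet> (P (t0 - h) *v e) < e \<bullet> (P t0 *v e)" using d(2)[of h] h t0T by auto
  moreover have "0 < e \<bullet> (P (t0 - h) *v e)" by (rule before) (use h e in auto)
  ultimately show False using e(2) by simp
qed

lemma riccati_solutionD:
  assumes "riccati_solution A S Q P" "t \<in> {0..T}"
  shows "(P has_vector_derivative A ** P t + P t ** transpose A - P t ** S ** P t + Q t) (at t within {0..T})"
  using assms unfolding riccati_solution_def by (auto intro: has_vector_derivative_within_subset)

lemma riccati_solution_continuous:
  "riccati_solution A S Q P \<Longrightarrow> continuous_on {0..T} P"
  using riccati_solutionD by (rule continuous_on_vector_derivative)

lemma norm_triple_product_le:
  "norm (X ** S ** Y) \<le> norm X * norm S * norm Y" for X :: "real ^ 'n ^ 'm"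
  by (meson mult_right_mono norm_ge_zero norm_matrix_matrix_mult_le order_trans)

text \<open>With \<open>E = P1 - P2\<close>, the quadratic terms differ by \<open>E S P1 + P2 S E\<close>. This is linear in \<open>E\<close> with coefficients
under control, and \<open>Q1 - Q2\<close> is the only forcing.\<close>
lemma riccati_stability:
  assumes P1: "riccati_solution A S Q1 P1" and P2: "riccati_solution A S Q2 P2"
    and bound: "\<And>t. t \<in> {0..T} \<Longrightarrow> norm (P1 t) \<le> p" "\<And>t. t \<in> {0..T} \<Longrightarrow> norm (P2 t) \<le> p"
    and Q: "\<And>t. t \<in> {0..T} \<Longrightarrow> norm (Q1 t - Q2 t) \<le> c"
    and "0 \<le> T"
  shows "(norm (P1 T - P2 T))\<^sup>2 \<le>
    exp ((2 * (2 * norm A + 2 * p * norm S) + 1) * T) * ((norm (P1 0 - P2 0))\<^sup>2 + T * c\<^sup>2)"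
proof (rule gronwall_norm)
  define E where "E t = P1 t - P2 t" for t
  define E' where "E' t = A ** E t + E t ** transpose A - (E t ** S ** P1 t + P2 t ** S ** E t) + (Q1 t - Q2 t)" for t
  show "((\<lambda>t. P1 t - P2 t) has_vector_derivative E' t) (at t within {0..T})" if "t \<in> {0..T}" for t
    using has_vector_derivative_diff[OF riccati_solutionD[OF P1 that] riccati_solutionD[OF P2 that]]
    by (simp add: E'_def E_def matrix_mult_diff_left matrix_mult_diff_right algebra_simps)
  have p: "0 \<le> p" using order_trans[OF norm_ge_zero bound(1)[of 0]] \<open>0 \<le> T\<close> by simp
  show "norm (E' t) \<le> (2 * norm A + 2 * p * norm S) * norm (P1 t - P2 t) + c" if t: "t \<in> {0..T}" for t
  proof -
    have "norm (E t ** S ** P1 t) \<le> norm (E t) * norm S * p"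
      by (rule order_trans[OF norm_triple_product_le]) (intro mult_left_mono bound t; simp)
    moreover have "norm (P2 t ** S ** E t) \<le> p * norm S * norm (E t)"
      by (rule order_trans[OF norm_triple_product_le]) (intro mult_right_mono bound t; simp)
    moreover have "norm (A ** E t) \<le> norm A * norm (E t)" by (rule norm_matrix_matrix_mult_le)
    moreover have "norm (E t ** transpose A) \<le> norm (E t) * norm A" by (metis norm_matrix_matrix_mult_le norm_transpose)
    moreover have "norm (Q1 t - Q2 t) \<le> c" by (rule Q[OF t])
    moreover have "norm (E' t) \<le> norm (A ** E t) + norm (E t ** transpose A) +
       (norm (E t ** S ** P1 t) + norm (P2 t ** S ** E t)) + norm (Q1 t - Q2 t)"
      using norm_triangle_ineq[of "A ** E t" "E t ** transpose A"]
        norm_triangle_ineq[of "E t ** S ** P1 t" "P2 t ** S ** E t"]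
        norm_triangle_ineq4[of "A ** E t + E t ** transpose A" "E t ** S ** P1 t + P2 t ** S ** E t"]
        norm_triangle_ineq[of "A ** E t + E t ** transpose A - (E t ** S ** P1 t + P2 t ** S ** E t)" "Q1 t - Q2 t"]
      unfolding E'_def by linarith
    ultimately show ?thesis by (simp add: E_def algebra_simps)
  qed
  show "0 \<le> 2 * norm A + 2 * p * norm S" using p by simp
qed (rule \<open>0 \<le> T\<close>)

lemma riccati_solution_transpose:
  assumes P: "riccati_solution A S Q P" and "transpose S = S" and "\<And>t. 0 \<le> t \<Longrightarrow> transpose (Q t) = Q t"
  shows "riccati_solution A S Q (\<lambda>t. transpose (P t))"
  unfolding riccati_solution_def
proof (intro allI impI)
  fix t :: real assume "0 \<le> t"
  then have "(P has_vector_derivative A ** P t + P t ** transpose A - P t ** S ** P t + Q t) (at t within {0..})"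
    using P by (simp add: riccati_solution_def)
  from bounded_linear.has_vector_derivative[OF bounded_linear_transpose this]
  show "((\<lambda>t. transpose (P t)) has_vector_derivative
     A ** transpose (P t) + transpose (P t) ** transpose A - transpose (P t) ** S ** transpose (P t) + Q t)
     (at t within {0..})"
    using assms(2,3) \<open>0 \<le> t\<close>
    by (simp add: transpose_add transpose_diff matrix_transpose_mul matrix_mul_assoc add.commute)
qed

text \<open>The transpose solves the same equation with the same initial value, so this is uniqueness.\<close>
lemma riccati_symmetric:
  assumes P: "riccati_solution A S Q P" and S: "transpose S = S" and Q: "\<And>t. 0 \<le> t \<Longrightarrow> transpose (Q t) = Q t"
    and "transpose (P 0) = P 0" "0 \<le> T"
  shows "transpose (P T) = P T"
proof -
  obtain p where "\<And>t. t \<in> {0..T} \<Longrightarrow> norm (P t) \<le> p"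
    using compact_interval_norm_bound[OF riccati_solution_continuous[OF P]] by blast
  then have "(norm (transpose (P T) - P T))\<^sup>2 \<le> exp ((2 * (2 * norm A + 2 * p * norm S) + 1) * T) *
      ((norm (transpose (P 0) - P 0))\<^sup>2 + T * 0\<^sup>2)"
    by (intro riccati_stability[OF riccati_solution_transpose[OF P S Q] P]) (use \<open>0 \<le> T\<close> in auto)
  then show ?thesis using assms(4) by simp
qed

text \<open>For \<open>P\<close> itself the derivative on a null vector is only nonnegative. Adding \<open>\<epsilon> exp (K t) I\<close> makes it strictly positive
when \<open>K\<close> dominates the linear terms and \<open>\<epsilon> exp (K T) \<le> 1\<close>, so that the term quadratic in \<open>\<epsilon>\<close> is
no larger than the linear ones. Then \<open>\<epsilon> \<rightarrow> 0\<close>.\<close>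
lemma riccati_sym_psd:
  assumes P: "riccati_solution A S Q P" and S: "sym_psd S" and Q: "\<And>t. 0 \<le> t \<Longrightarrow> sym_psd (Q t)"
    and init: "sym_psd (P 0)" and "0 \<le> T"
  shows "sym_psd (P T)"
proof -
  have sym: "transpose (P t) = P t" if "0 \<le> t" for t
    
  proof (rule riccati_symmetric[OF P])
  qed (use S Q init that in \<open>auto simp: sym_psd_def\<close>)
  \<comment> \<open>The linear terms amount to at most \<open>2 * norm A + norm S\<close>; the \<open>1\<close> gives strictness.\<close>
  define K where "K = 2 * norm A + norm S + 1"
  have perturbed: "0 \<le> x \<bullet> (P T *v x) + e * exp (K * T) * (x \<bullet> x)"
    if e: "0 < e" "e \<le> exp (- (K * T))" for e x
  proof (cases "x = 0")
    case False
    \<comment> \<open>Monotone in \<open>t\<close>, so that \<open>g \<le> 1\<close> on the whole interval by the choice of \<open>e\<close>.\<close>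
    define g where "g t = e * exp (K * t)" for t
    define P' where "P' t = A ** P t + P t ** transpose A - P t ** S ** P t + Q t" for t
    have g: "0 < g t" "g t \<le> 1" if "t \<in> {0..T}" for t
    proof -
      have "e * exp (K * t) \<le> exp (- (K * T)) * exp (K * T)"
        using e that by (intro mult_mono) (auto simp: K_def intro!: mult_left_mono)
      then show "g t \<le> 1" by (simp add: g_def exp_minus_inverse mult.commute flip: exp_add)
    qed (use e in \<open>simp add: g_def\<close>)
    have "0 < x \<bullet> ((P T + g T *\<^sub>R mat 1) *v x)"
    proof (rule path_stays_positive_definite[where P = "\<lambda>t. P t + g t *\<^sub>R mat 1" and P' = "\<lambda>t. P' t + (K * g t) *\<^sub>R mat 1"])
      fix t assume t: "t \<in> {0..T}"
      have "(g has_vector_derivative K * g t) (at t within {0..T})"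
        unfolding g_def has_real_derivative_iff_has_vector_derivative[symmetric]
        by (auto intro!: derivative_eq_intros)
      then show "((\<lambda>t. P t + g t *\<^sub>R mat 1) has_vector_derivative P' t + (K * g t) *\<^sub>R mat 1) (at t within {0..T})"
        unfolding P'_def
        by (intro has_vector_derivative_add riccati_solutionD[OF P t] 
          bounded_linear.has_vector_derivative[OF bounded_linear_scaleR_left])
      show "transpose (P t + g t *\<^sub>R mat 1) = P t + g t *\<^sub>R mat 1"
        using sym t by (simp add: transpose_add transpose_scalar transpose_mat)
      fix y :: "real ^ 'a" assume "y \<noteq> 0" and null: "(P t + g t *\<^sub>R mat 1) *v y = 0"
      have Py: "P t *v y = - (g t *\<^sub>R y)"
        using null by (simp add: matrix_vector_mult_add_rdistrib scaleR_matrix_vector_assoc[symmetric] eq_neg_iff_add_eq_0)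
      have tP: "transpose (P t) = P t" using sym t by simp
      have "y \<bullet> (P' t *v y) = y \<bullet> (A *v (P t *v y)) + (P t *v y) \<bullet> (transpose A *v y) - 
          (P t *v y) \<bullet> (S *v (P t *v y)) + y \<bullet> (Q t *v y)"
        by (simp add: P'_def matrix_vector_mult_add_rdistrib matrix_vector_mult_diff_rdistrib inner_add_right inner_diff_right
          inner_matrix_transpose[of _ "P t"] tP flip: matrix_vector_mul_assoc)
      also have "\<dots> = - (2 * g t * (y \<bullet> (A *v y))) - (g t)\<^sup>2 * (y \<bullet> (S *v y)) + y \<bullet> (Q t *v y)"
        unfolding Py by (simp add: matrix_vector_mult_scaleR inner_matrix_transpose[of _ A] power2_eq_square
            bounded_bilinear.minus_right[OF bounded_bilinear_matrix_vector_mult] inner_commute)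
      also have "\<dots> \<ge> - (2 * g t * (norm A * (y \<bullet> y))) - g t * (norm S * (y \<bullet> y)) + 0"
      proof (intro add_mono diff_mono)
        have quad: "y \<bullet> (B *v y) \<le> norm B * (y \<bullet> y)" for B :: "real ^ 'a ^ 'a"
        proof -
          have "y \<bullet> (B *v y) \<le> norm y * (norm B * norm y)"
            by (meson mult_left_mono norm_cauchy_schwarz norm_ge_zero norm_matrix_vector_mult_le order_trans)
          then show ?thesis by (simp add: power2_norm_eq_inner[symmetric] power2_eq_square mult_ac)
        qed
        show "- (2 * g t * (norm A * (y \<bullet> y))) \<le> - (2 * g t * (y \<bullet> (A *v y)))"
          using quad[of A] g[OF t] by simp
        have "(g t)\<^sup>2 * (y \<bullet> (S *v y)) \<le> g t * (y \<bullet> (S *v y))"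
          using g[OF t] sym_psdD(2)[OF S] by (intro mult_right_mono) (auto simp: power2_eq_square mult_left_le)
        also have "\<dots> \<le> g t * (norm S * (y \<bullet> y))" using quad[of S] g[OF t] by simp
        finally show "(g t)\<^sup>2 * (y \<bullet> (S *v y)) \<le> g t * (norm S * (y \<bullet> y))" .
        show "0 \<le> y \<bullet> (Q t *v y)" using Q t by (intro sym_psdD(2)) auto
      qed
      finally have "y \<bullet> (P' t *v y) \<ge> - ((K - 1) * g t * (y \<bullet> y))"
        by (simp add: K_def algebra_simps)
      moreover have "0 < g t * (y \<bullet> y)" using g[OF t] \<open>y \<noteq> 0\<close> by simp
      ultimately show "0 < y \<bullet> ((P' t + (K * g t) *\<^sub>R mat 1) *v y)"
        by (simp add: matrix_vector_mult_add_rdistrib scaleR_matrix_vector_assoc[symmetric] inner_add_right algebra_simps)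
    next
      fix y :: "real ^ 'a" assume "y \<noteq> 0"
      then show "0 < y \<bullet> ((P 0 + g 0 *\<^sub>R mat 1) *v y)"
        using sym_psdD(2)[OF init, of y] g[of 0] \<open>0 \<le> T\<close>
        by (simp add: matrix_vector_mult_add_rdistrib scaleR_matrix_vector_assoc[symmetric] inner_add_right add_nonneg_pos)
    qed (use \<open>0 \<le> T\<close> False in auto)
    then show ?thesis 
      by (simp add: g_def matrix_vector_mult_add_rdistrib scaleR_matrix_vector_assoc[symmetric] inner_add_right)
  qed simp
  have "0 \<le> x \<bullet> (P T *v x)" for x
  proof (rule tendsto_lowerbound)
    show "((\<lambda>e. x \<bullet> (P T *v x) + e * exp (K * T) * (x \<bullet> x)) \<longlongrightarrow> x \<bullet> (P T *v x)) (at_right 0)"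
      by (rule tendsto_eq_intros refl | simp)+
    show "\<forall>\<^sub>F e in at_right 0. 0 \<le> x \<bullet> (P T *v x) + e * exp (K * T) * (x \<bullet> x)"
      unfolding eventually_at_right_field
      by (rule exI[of _ "exp (- (K * T))"]) (use perturbed in auto)
  qed simp
  then show ?thesis using sym[OF \<open>0 \<le> T\<close>] by (simp add: sym_psd_def)
qed

text \<open>Gronwall's bound for the trace, with the dimension factors of the passage between norm and trace.\<close>
definition riccati_bound :: "real ^ 'd ^ 'd \<Rightarrow> real \<Rightarrow> real \<Rightarrow> real \<Rightarrow> real" where
  "riccati_bound A q \<rho> T = real CARD('d) * (exp (2 * (real CARD('d))\<^sup>2 * norm A * T) *
     (real CARD('d) * \<rho> + T * (real CARD('d) * q)))"

lemma riccati_bound_mono: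
  "0 \<le> q \<Longrightarrow> 0 \<le> \<rho> \<Longrightarrow> 0 \<le> s \<Longrightarrow> s \<le> t \<Longrightarrow> riccati_bound A q \<rho> s \<le> riccati_bound A q \<rho> t"
  unfolding riccati_bound_def
  by (intro mult_left_mono mult_mono add_mono mult_right_mono) (auto intro!: mult_left_mono add_nonneg_nonneg)

text \<open>The trace satisfies a linear differential inequality since \<open>tr (P S P) \<ge> 0\<close>; this uses that \<open>P\<close> is symmetric.
Positivity of \<open>P\<close> is then used twice, to bound \<open>tr (A P)\<close> by the trace of \<open>P\<close> and to return from the trace to the norm.\<close>
lemma riccati_norm_bound:
  fixes A :: "real ^ 'd ^ 'd"
  assumes P: "riccati_solution A S Q P" and S: "sym_psd S" and Q: "\<And>t. 0 \<le> t \<Longrightarrow> sym_psd (Q t)"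
    and init: "sym_psd (P 0)" and "0 \<le> T"
    and q: "\<And>t. 0 \<le> t \<Longrightarrow> norm (Q t) \<le> q" and \<rho>: "norm (P 0) \<le> \<rho>"
  shows "norm (P T) \<le> riccati_bound A q \<rho> T"
proof -
  let ?d = "real CARD('d)"
  have psd: "sym_psd (P t)" if "0 \<le> t" for t using riccati_sym_psd[OF P S Q init that] .
  have "0 \<le> q" using order_trans[OF norm_ge_zero q[of 0]] by simp
  have "trace (P T) \<le> exp (2 * ?d\<^sup>2 * norm A * T) * (trace (P 0) + integral {0..T} (\<lambda>_. ?d * q))"
  proof (rule gronwall)
    fix t assume t: "t \<in> {0..T}"
    show "((\<lambda>t. trace (P t)) has_vector_derivative
        trace (A ** P t + P t ** transpose A - P t ** S ** P t + Q t)) (at t within {0..T})"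
      by (rule bounded_linear.has_vector_derivative[OF bounded_linear_trace riccati_solutionD[OF P t]])
    have "trace (P t ** transpose A) = trace (A ** P t)"
      using psd[of t] t by (metis atLeastAtMost_iff matrix_transpose_mul sym_psdD(1) trace_transpose transpose_transpose)
    moreover have "0 \<le> trace (P t ** S ** P t)"
      using trace_sym_psd_nonneg[OF sym_psd_congruence[OF S, of "P t"]] sym_psdD(1)[OF psd[of t]] t by simp
    moreover have "trace (Q t) \<le> ?d * q"
    proof -
      have "trace (Q t) \<le> ?d * norm (Q t)" using trace_le_norm[of "Q t"] by linarith
      also have "\<dots> \<le> ?d * q" using q[of t] t by (intro mult_left_mono) auto
      finally show ?thesis .
    qed
    moreover have "trace (A ** P t) \<le> ?d\<^sup>2 * norm A * trace (P t)"
    proof -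
      have "trace (A ** P t) \<le> ?d * norm (A ** P t)" using trace_le_norm[of "A ** P t"] by linarith
      also have "\<dots> \<le> ?d * (norm A * norm (P t))" by (intro mult_left_mono norm_matrix_matrix_mult_le) simp
      also have "\<dots> \<le> ?d * (norm A * (?d * trace (P t)))"
        using t by (intro mult_left_mono sym_psd_norm_le_trace psd) auto
      finally show ?thesis by (simp add: power2_eq_square mult_ac)
    qed
    ultimately show "trace (A ** P t + P t ** transpose A - P t ** S ** P t + Q t) \<le> 2 * ?d\<^sup>2 * norm A * trace (P t) + ?d * q"
      by (simp add: trace_add trace_sub)
  qed (use \<open>0 \<le> q\<close> \<open>0 \<le> T\<close> in auto)
  also have "\<dots> \<le> exp (2 * ?d\<^sup>2 * norm A * T) * (?d * \<rho> + T * (?d * q))"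
  proof (intro mult_left_mono add_mono)
    show "trace (P 0) \<le> ?d * \<rho>" 
      using trace_le_norm[of "P 0"] mult_left_mono[OF \<rho>, of ?d] by linarith
  qed (use \<open>0 \<le> T\<close> in auto)
  finally have "?d * trace (P T) \<le> riccati_bound A q \<rho> T"
    unfolding riccati_bound_def by (intro mult_left_mono) auto
  with sym_psd_norm_le_trace[OF psd[OF \<open>0 \<le> T\<close>]] show ?thesis by simp
qed

section \<open>Second moments of the stochastic integral\<close>

text \<open>The mixed terms of the square have expectation \<open>0\<close> by independence.\<close>
lemma (in prob_space) second_moment_sum_indep:
  fixes Y :: "nat \<Rightarrow> 'a \<Rightarrow> real"
  assumes indep: "indep_vars (\<lambda>_. borel) Y {..<n}"
    and int: "\<And>i. i < n \<Longrightarrow> integrable M (Y i)" and mean: "\<And>i. i < n \<Longrightarrow> expectation (Y i) = 0"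
    and sq: "\<And>i. i < n \<Longrightarrow> integrable M (\<lambda>\<omega>. (Y i \<omega>)\<^sup>2)"
  shows "integrable M (\<lambda>\<omega>. (\<Sum>i<n. Y i \<omega>)\<^sup>2)"
    and "expectation (\<lambda>\<omega>. (\<Sum>i<n. Y i \<omega>)\<^sup>2) = (\<Sum>i<n. expectation (\<lambda>\<omega>. (Y i \<omega>)\<^sup>2))"
proof -
  have square: "(\<Sum>i<n. Y i \<omega>)\<^sup>2 = (\<Sum>i<n. \<Sum>j<n. Y i \<omega> * Y j \<omega>)" for \<omega>
    by (simp add: power2_eq_square sum_product)
  have pair: "integrable M (\<lambda>\<omega>. Y i \<omega> * Y j \<omega>) \<and>
      expectation (\<lambda>\<omega>. Y i \<omega> * Y j \<omega>) = (if i = j then expectation (\<lambda>\<omega>. (Y i \<omega>)\<^sup>2) else 0)"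
    if "i < n" "j < n" for i j
  proof (cases "i = j")
    case False
    have ij: "indep_vars (\<lambda>_. borel) Y {i, j}"
      by (rule indep_vars_subset[OF indep]) (use that in auto)
    have int': "\<And>k. k \<in> {i, j} \<Longrightarrow> integrable M (Y k)" using that int by auto
    show ?thesis
      using indep_vars_lebesgue_integral[OF _ ij int'] indep_vars_integrable[OF _ ij int'] False
        mean[OF that(1)] by simp
  qed (use sq that in \<open>simp add: power2_eq_square\<close>)
  show "integrable M (\<lambda>\<omega>. (\<Sum>i<n. Y i \<omega>)\<^sup>2)"
    unfolding square using pair by (intro Bochner_Integration.integrable_sum) auto
  have "expectation (\<lambda>\<omega>. (\<Sum>i<n. Y i \<omega>)\<^sup>2) = (\<Sum>i<n. \<Sum>j<n. expectation (\<lambda>\<omega>. Y i \<omega> * Y j \<omega>))"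
  proof -
    have "expectation (\<lambda>\<omega>. \<Sum>i<n. \<Sum>j<n. Y i \<omega> * Y j \<omega>) = (\<Sum>i<n. expectation (\<lambda>\<omega>. \<Sum>j<n. Y i \<omega> * Y j \<omega>))"
      using pair by (intro Bochner_Integration.integral_sum Bochner_Integration.integrable_sum) auto
    also have "\<dots> = (\<Sum>i<n. \<Sum>j<n. expectation (\<lambda>\<omega>. Y i \<omega> * Y j \<omega>))"
      using pair by (intro sum.cong refl Bochner_Integration.integral_sum) auto
    finally show ?thesis unfolding square .
  qed
  also have "\<dots> = (\<Sum>i<n. \<Sum>j<n. if i = j then expectation (\<lambda>\<omega>. (Y i \<omega>)\<^sup>2) else 0)"
    using pair by (intro sum.cong) auto
  also have "\<dots> = (\<Sum>i<n. expectation (\<lambda>\<omega>. (Y i \<omega>)\<^sup>2))" by (simp add: sum.delta)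
  finally show "expectation (\<lambda>\<omega>. (\<Sum>i<n. Y i \<omega>)\<^sup>2) = (\<Sum>i<n. expectation (\<lambda>\<omega>. (Y i \<omega>)\<^sup>2))" .
qed

lemma brownian_motion_prob_space: "brownian_motion M V \<Longrightarrow> prob_space M"
  by (simp add: brownian_motion_def)

lemma brownian_motion_measurable: "brownian_motion M V \<Longrightarrow> 0 \<le> t \<Longrightarrow> V t \<in> borel_measurable M"
  by (simp add: brownian_motion_def)

lemma brownian_increment_moments:
  assumes V: "brownian_motion M V" and "0 \<le> s" "s \<le> t"
  shows "integrable M (\<lambda>\<omega>. (V t \<omega> - V s \<omega>) $ j)" (is ?int)
    and "(\<integral>\<omega>. (V t \<omega> - V s \<omega>) $ j \<partial>M) = 0" (is ?mean)
    and "integrable M (\<lambda>\<omega>. ((V t \<omega> - V s \<omega>) $ j)\<^sup>2)" (is ?sq)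
    and "(\<integral>\<omega>. ((V t \<omega> - V s \<omega>) $ j)\<^sup>2 \<partial>M) = t - s" (is ?var)
proof -
  interpret prob_space M using V by (rule brownian_motion_prob_space)
  have "?int \<and> ?mean \<and> ?sq \<and> ?var"
  proof (cases "s = t")
    case False
    define \<sigma> where "\<sigma> = sqrt (t - s)"
    have \<sigma>: "0 < \<sigma>" "\<sigma>\<^sup>2 = t - s" using False \<open>s \<le> t\<close> by (auto simp: \<sigma>_def)
    have D: "distributed M lborel (\<lambda>\<omega>. (V t \<omega> - V s \<omega>) $ j) (\<lambda>x. ennreal (normal_density 0 \<sigma> x))"
      using V False assms(2,3) by (auto simp: brownian_motion_def \<sigma>_def)
    have ?int
      using distributed_integrable[OF D, of "\<lambda>x. x"] integrable_normal_moment[OF \<sigma>(1), of 0 1] by simp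
    moreover have ?mean by (rule normal_distributed_expectation[OF \<sigma>(1) D])
    moreover have ?sq
      using distributed_integrable[OF D, of "\<lambda>x. x\<^sup>2"] integrable_normal_moment[OF \<sigma>(1), of 0 2] by simp
    moreover have ?var
      using normal_distributed_variance[OF \<sigma>(1) D] normal_distributed_expectation[OF \<sigma>(1) D] \<sigma>(2) by simp
    ultimately show ?thesis by blast
  qed simp
  then show ?int ?mean ?sq ?var by blast+
qed

lemma partition_bounds:
  fixes \<tau> :: "nat \<Rightarrow> real"
  assumes "\<And>i. i < n \<Longrightarrow> \<tau> i \<le> \<tau> (Suc i)" "i \<le> n"
  shows "\<tau> 0 \<le> \<tau> i" "\<tau> i \<le> \<tau> n"
proof -
  show "\<tau> 0 \<le> \<tau> i" using assms(2)
    by (induction i) (use assms(1) in \<open>auto intro: order_trans simp: less_eq_Suc_le\<close>)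
  show "\<tau> i \<le> \<tau> n" using assms(2)
    by (induction i rule: inc_induct) (use assms(1) in \<open>auto intro: order_trans\<close>)
qed

lemma power2_norm_eq_sum_power2: "(norm x)\<^sup>2 = (\<Sum>j\<in>UNIV. (x $ j)\<^sup>2)" for x :: "real ^ 'n"
  unfolding power2_norm_eq_inner inner_vec_def by (simp add: power2_eq_square)

lemma borel_measurable_matrix_vector_mult [measurable]:
  fixes B :: "real ^ 'k ^ 'd"
  assumes "g \<in> borel_measurable M"
  shows "(\<lambda>\<omega>. B *v g \<omega>) \<in> borel_measurable M"
  by (rule borel_measurable_continuous_on[OF _ assms]) (rule matrix_vector_mult_linear_continuous_on)

lemma borel_measurable_vec_component [measurable]:
  fixes g :: "'w \<Rightarrow> real ^ 'k"
  assumes "g \<in> borel_measurable M"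
  shows "(\<lambda>\<omega>. g \<omega> $ j) \<in> borel_measurable M"
  by (rule borel_measurable_continuous_on[OF _ assms]) (intro continuous_intros)

text \<open>The Ito isometry for step functions, as an upper bound: increments over disjoint intervals are independent and centred,
so only the diagonal terms remain.\<close>
lemma brownian_sum_second_moment:
  fixes G :: "nat \<Rightarrow> real ^ 'k ^ 'd" and V :: "real \<Rightarrow> 'w \<Rightarrow> real ^ 'k"
  assumes V: "brownian_motion M V" and "0 \<le> \<tau> 0" and mono: "\<And>i. i < n \<Longrightarrow> \<tau> i \<le> \<tau> (Suc i)"
    and G: "\<And>i. i < n \<Longrightarrow> norm (G i) \<le> \<eta>"
  shows "(\<integral>\<^sup>+\<omega>. ennreal ((norm (\<Sum>i<n. G i *v (V (\<tau> (Suc i)) \<omega> - V (\<tau> i) \<omega>)))\<^sup>2) \<partial>M)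
     \<le> ennreal (\<eta>\<^sup>2 * (real CARD('k) * (\<tau> n - \<tau> 0)))"
proof -
  interpret prob_space M using V by (rule brownian_motion_prob_space)
  define D where "D i \<omega> = V (\<tau> (Suc i)) \<omega> - V (\<tau> i) \<omega>" for i \<omega>
  have \<tau>0: "0 \<le> \<tau> i" if "i \<le> n" for i
    using partition_bounds(1)[of n \<tau>, OF mono that] \<open>0 \<le> \<tau> 0\<close> by linarith
  note mom = brownian_increment_moments[OF V \<tau>0 mono, folded D_def]
  have D_meas [measurable]: "D i \<in> borel_measurable M" if "i < n" for i
    unfolding D_def using that by (intro borel_measurable_diff brownian_motion_measurable[OF V] \<tau>0) auto
  have D_sq: "integrable M (\<lambda>\<omega>. (norm (D i \<omega>))\<^sup>2)"
    "expectation (\<lambda>\<omega>. (norm (D i \<omega>))\<^sup>2) = real CARD('k) * (\<tau> (Suc i) - \<tau> i)" if "i < n" for i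
    using mom[of i] that by (auto simp: power2_norm_eq_sum_power2 Bochner_Integration.integral_sum)
  define Y where "Y a i \<omega> = (G i *v D i \<omega>) $ a" for a i \<omega>
  have Y_norm: "(norm (G i *v D i \<omega>))\<^sup>2 \<le> \<eta>\<^sup>2 * (norm (D i \<omega>))\<^sup>2" if "i < n" for i \<omega>
  proof -
    have "norm (G i *v D i \<omega>) \<le> \<eta> * norm (D i \<omega>)"
      by (rule order_trans[OF norm_matrix_vector_mult_le]) (intro mult_right_mono G that norm_ge_zero)
    then show ?thesis by (metis norm_ge_zero power_mono power_mult_distrib)
  qed
  have Y_le: "(Y a i \<omega>)\<^sup>2 \<le> \<eta>\<^sup>2 * (norm (D i \<omega>))\<^sup>2" if "i < n" for a i \<omega>
  proof -
    have "\<bar>Y a i \<omega>\<bar> \<le> norm (G i *v D i \<omega>)" unfolding Y_def by (rule component_le_norm_cart)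
    then have "(Y a i \<omega>)\<^sup>2 \<le> (norm (G i *v D i \<omega>))\<^sup>2" by (metis abs_ge_zero power2_abs power_mono)
    with Y_norm[OF that, of \<omega>] show ?thesis by linarith
  qed
  have "indep_vars (\<lambda>_. borel) D {..<n}"
    using V mono \<open>0 \<le> \<tau> 0\<close> unfolding brownian_motion_def D_def[abs_def] by blast
  then have indep: "indep_vars (\<lambda>_. borel) (Y a) {..<n}" for a
    unfolding Y_def[abs_def] by (rule indep_vars_compose2) measurable
  have int: "integrable M (Y a i)" and mean: "expectation (Y a i) = 0" if "i < n" for a i
    using mom[of i] that by (auto simp: Y_def[abs_def] matrix_vector_mult_def Bochner_Integration.integral_sum)
  have sq: "integrable M (\<lambda>\<omega>. (Y a i \<omega>)\<^sup>2)" if "i < n" for a i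
  proof (rule Bochner_Integration.integrable_bound)
    show "integrable M (\<lambda>\<omega>. \<eta>\<^sup>2 * (norm (D i \<omega>))\<^sup>2)" using D_sq(1)[OF that] by simp
    show "(\<lambda>\<omega>. (Y a i \<omega>)\<^sup>2) \<in> borel_measurable M" using int[OF that, of a] by measurable
    show "AE \<omega> in M. norm ((Y a i \<omega>)\<^sup>2) \<le> norm (\<eta>\<^sup>2 * (norm (D i \<omega>))\<^sup>2)" using Y_le[OF that] by simp
  qed
  have norm_sum: "(norm (\<Sum>i<n. G i *v D i \<omega>))\<^sup>2 = (\<Sum>a\<in>UNIV. (\<Sum>i<n. Y a i \<omega>)\<^sup>2)" for \<omega>
    by (simp add: power2_norm_eq_sum_power2 Y_def)
  note sums = second_moment_sum_indep[OF indep int mean sq]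
  have integrable: "integrable M (\<lambda>\<omega>. (norm (\<Sum>i<n. G i *v D i \<omega>))\<^sup>2)"
    unfolding norm_sum by (intro Bochner_Integration.integrable_sum sums)
  have "expectation (\<lambda>\<omega>. (norm (\<Sum>i<n. G i *v D i \<omega>))\<^sup>2) = (\<Sum>a\<in>UNIV. \<Sum>i<n. expectation (\<lambda>\<omega>. (Y a i \<omega>)\<^sup>2))"
    unfolding norm_sum by (subst Bochner_Integration.integral_sum) (simp_all add: sums)
  also have "\<dots> = (\<Sum>i<n. \<Sum>a\<in>UNIV. expectation (\<lambda>\<omega>. (Y a i \<omega>)\<^sup>2))" by (rule sum.swap)
  also have "\<dots> = (\<Sum>i<n. expectation (\<lambda>\<omega>. (norm (G i *v D i \<omega>))\<^sup>2))"
    using sq by (intro sum.cong refl) (simp add: power2_norm_eq_sum_power2 Bochner_Integration.integral_sum Y_def)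
  also have "\<dots> \<le> (\<Sum>i<n. expectation (\<lambda>\<omega>. \<eta>\<^sup>2 * (norm (D i \<omega>))\<^sup>2))"
    using sq D_sq(1) Y_norm
    by (intro sum_mono integral_mono) (auto simp: power2_norm_eq_sum_power2[of "_ *v _"] simp flip: Y_def)
  also have "\<dots> = (\<Sum>i<n. \<eta>\<^sup>2 * (real CARD('k) * (\<tau> (Suc i) - \<tau> i)))"
    by (intro sum.cong refl) (simp add: D_sq)
  also have "\<dots> = \<eta>\<^sup>2 * (real CARD('k) * (\<tau> n - \<tau> 0))"
    by (simp add: sum_lessThan_telescope flip: sum_distrib_left)
  finally show ?thesis
    using integrable by (simp add: nn_integral_eq_integral D_def ennreal_leI)
qed

lemma power2_norm_add_le: "(norm (x + y))\<^sup>2 \<le> 2 * (norm x)\<^sup>2 + 2 * (norm y)\<^sup>2"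
  for x y :: "'a::real_normed_vector"
proof -
  have "(norm (x + y))\<^sup>2 \<le> (norm x + norm y)\<^sup>2"
    by (intro power_mono norm_triangle_ineq norm_ge_zero)
  also have "\<dots> \<le> 2 * (norm x)\<^sup>2 + 2 * (norm y)\<^sup>2"
    using sum_squares_bound[of "norm x" "norm y"] by (simp add: power2_sum)
  finally show ?thesis .
qed

lemma nn_integral_power2_norm_add_le:
  fixes Y W :: "'w \<Rightarrow> 'a::euclidean_space"
  assumes [measurable]: "Y \<in> borel_measurable M" "W \<in> borel_measurable M"
  shows "(\<integral>\<^sup>+\<omega>. ennreal ((norm (Y \<omega> + W \<omega>))\<^sup>2) \<partial>M) \<le>
    2 * (\<integral>\<^sup>+\<omega>. ennreal ((norm (Y \<omega>))\<^sup>2) \<partial>M) + 2 * (\<integral>\<^sup>+\<omega>. ennreal ((norm (W \<omega>))\<^sup>2) \<partial>M)"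
proof -
  have "ennreal ((norm (Y \<omega> + W \<omega>))\<^sup>2) \<le> 2 * ennreal ((norm (Y \<omega>))\<^sup>2) + 2 * ennreal ((norm (W \<omega>))\<^sup>2)" for \<omega>
    using power2_norm_add_le[of "Y \<omega>" "W \<omega>"]
    by (simp add: ennreal_leI flip: ennreal_plus ennreal_mult ennreal_numeral)
  then have "(\<integral>\<^sup>+\<omega>. ennreal ((norm (Y \<omega> + W \<omega>))\<^sup>2) \<partial>M) \<le>
    (\<integral>\<^sup>+\<omega>. (2 * ennreal ((norm (Y \<omega>))\<^sup>2) + 2 * ennreal ((norm (W \<omega>))\<^sup>2)) \<partial>M)"
    by (intro nn_integral_mono)
  also have "\<dots> = 2 * (\<integral>\<^sup>+\<omega>. ennreal ((norm (Y \<omega>))\<^sup>2) \<partial>M) + 2 * (\<integral>\<^sup>+\<omega>. ennreal ((norm (W \<omega>))\<^sup>2) \<partial>M)"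
    by (simp add: nn_integral_add nn_integral_cmult)
  finally show ?thesis .
qed

lemma ito_integral_measurable: "ito_integral M G Z t I \<Longrightarrow> I \<in> borel_measurable M"
  by (simp add: ito_integral_def)

text \<open>Linearity passes to the mean-square limit. It is what makes the noise in the difference of the two means an integral
of the small gain difference.\<close>
lemma ito_integral_diff:
  fixes G1 G2 :: "real \<Rightarrow> real ^ 'k ^ 'd"
  assumes I1: "ito_integral M G1 Z t I1" and I2: "ito_integral M G2 Z t I2"
    and Z: "\<And>s. 0 \<le> s \<Longrightarrow> Z s \<in> borel_measurable M"
  shows "ito_integral M (\<lambda>s. G1 s - G2 s) Z t (\<lambda>\<omega>. I1 \<omega> - I2 \<omega>)"
  unfolding ito_integral_def
proof (intro conjI allI impI)
  note [measurable] = ito_integral_measurable[OF I1] ito_integral_measurable[OF I2]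
  show "(\<lambda>\<omega>. I1 \<omega> - I2 \<omega>) \<in> borel_measurable M" by measurable
  fix e :: real assume "0 < e"
  then have e8: "0 < e / 8" by simp
  let ?S = "\<lambda>G (n::nat) \<tau> \<omega>. \<Sum>i<n. G (\<tau> i) *v (Z (\<tau> (Suc i)) \<omega> - Z (\<tau> i) \<omega>)"
  let ?part = "\<lambda>\<delta> (n::nat) \<tau>. \<tau> 0 = 0 \<and> \<tau> n = t \<and> (\<forall>i<n. \<tau> i \<le> \<tau> (Suc i) \<and> \<tau> (Suc i) - \<tau> i < \<delta>)"
  obtain \<delta>1 where \<delta>1: "0 < \<delta>1" "\<And>n \<tau>. ?part \<delta>1 n \<tau> \<Longrightarrow>
      (\<integral>\<^sup>+\<omega>. ennreal ((norm (?S G1 n \<tau> \<omega> - I1 \<omega>))\<^sup>2) \<partial>M) < ennreal (e / 8)"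
    using I1 e8 unfolding ito_integral_def by blast
  obtain \<delta>2 where \<delta>2: "0 < \<delta>2" "\<And>n \<tau>. ?part \<delta>2 n \<tau> \<Longrightarrow>
      (\<integral>\<^sup>+\<omega>. ennreal ((norm (?S G2 n \<tau> \<omega> - I2 \<omega>))\<^sup>2) \<partial>M) < ennreal (e / 8)"
    using I2 e8 unfolding ito_integral_def by blast
  have "(\<integral>\<^sup>+\<omega>. ennreal ((norm (?S (\<lambda>s. G1 s - G2 s) n \<tau> \<omega> - (I1 \<omega> - I2 \<omega>)))\<^sup>2) \<partial>M) < ennreal e"
    if part: "?part (min \<delta>1 \<delta>2) n \<tau>" for n and \<tau> :: "nat \<Rightarrow> real"
  proof -
    have "0 \<le> \<tau> i" if "i \<le> n" for i using partition_bounds(1)[of n \<tau> i] part that by auto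
    then have S: "(\<lambda>\<omega>. ?S G n \<tau> \<omega>) \<in> borel_measurable M" for G :: "real \<Rightarrow> real ^ 'k ^ 'd"
      by (intro borel_measurable_sum borel_measurable_matrix_vector_mult borel_measurable_diff Z) auto
    have split: "?S (\<lambda>s. G1 s - G2 s) n \<tau> \<omega> - (I1 \<omega> - I2 \<omega>) = 
        (?S G1 n \<tau> \<omega> - I1 \<omega>) + (I2 \<omega> - ?S G2 n \<tau> \<omega>)" for \<omega>
      by (simp add: matrix_vector_mult_diff_rdistrib sum_subtractf)
    have "(\<integral>\<^sup>+\<omega>. ennreal ((norm (?S (\<lambda>s. G1 s - G2 s) n \<tau> \<omega> - (I1 \<omega> - I2 \<omega>)))\<^sup>2) \<partial>M) \<le>
       2 * (\<integral>\<^sup>+\<omega>. ennreal ((norm (?S G1 n \<tau> \<omega> - I1 \<omega>))\<^sup>2) \<partial>M) +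
       2 * (\<integral>\<^sup>+\<omega>. ennreal ((norm (I2 \<omega> - ?S G2 n \<tau> \<omega>))\<^sup>2) \<partial>M)"
      unfolding split by (intro nn_integral_power2_norm_add_le borel_measurable_diff S) measurable
    also have "\<dots> \<le> 2 * ennreal (e / 8) + 2 * ennreal (e / 8)"
      using \<delta>1(2)[of \<tau> n] \<delta>2(2)[of \<tau> n] part
      by (intro add_mono mult_left_mono) (auto simp: norm_minus_commute less_imp_le)
    also have "\<dots> = ennreal (e / 2)" using \<open>0 < e\<close>
      by (simp flip: ennreal_plus ennreal_mult ennreal_numeral)
    also have "\<dots> < ennreal e" using \<open>0 < e\<close> by (simp add: ennreal_less_iff)
    finally show ?thesis .
  qed
  then show "\<exists>\<delta>>0. \<forall>n \<tau>. ?part \<delta> n \<tau> \<longrightarrow>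
      (\<integral>\<^sup>+\<omega>. ennreal ((norm (?S (\<lambda>s. G1 s - G2 s) n \<tau> \<omega> - (I1 \<omega> - I2 \<omega>)))\<^sup>2) \<partial>M) < ennreal e"
    using \<delta>1(1) \<delta>2(1) by (intro exI[of _ "min \<delta>1 \<delta>2"]) auto
qed

lemma observation_measurable:
  "brownian_motion M V \<Longrightarrow> 0 \<le> t \<Longrightarrow> observation H \<Gamma>h X V t \<in> borel_measurable M"
  unfolding observation_def[abs_def] using brownian_motion_measurable[of M V t] by measurable

text \<open>On a uniform partition the left-endpoint sum splits into a deterministic part, driven by the signal, and a Brownian sum;
both are bounded in terms of \<open>\<eta>\<close> uniformly in the partition. The error of the approximating sum enters only additively and
is arbitrarily small, so the bound is homogeneous in \<open>\<eta>\<close>.\<close>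
lemma ito_integral_second_moment:
  fixes G :: "real \<Rightarrow> real ^ 'k ^ 'd" and H :: "real ^ 'm ^ 'k" and \<Gamma>h :: "real ^ 'k ^ 'k"
    and V :: "real \<Rightarrow> 'w \<Rightarrow> real ^ 'k" 
  assumes V: "brownian_motion M V" and X: "continuous_on {0..} X"
    and I: "ito_integral M G (observation H \<Gamma>h X V) t I"
    and t: "0 \<le> t" and G: "\<And>s. s \<in> {0..t} \<Longrightarrow> norm (G s) \<le> \<eta>"
    and h: "\<And>s. s \<in> {0..t} \<Longrightarrow> norm (H *v X s) \<le> h"
  shows "(\<integral>\<^sup>+\<omega>. ennreal ((norm (I \<omega>))\<^sup>2) \<partial>M) \<le>
    ennreal (4 * \<eta>\<^sup>2 * ((h * t)\<^sup>2 + (norm \<Gamma>h)\<^sup>2 * (real CARD('k) * t)))"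
proof (rule ennreal_le_epsilon)
  interpret prob_space M using V by (rule brownian_motion_prob_space)
  define Z where "Z = observation H \<Gamma>h X V"
  fix e :: real assume "0 < e"
  then have e2: "0 < e / 2" by simp
  obtain \<delta> where \<delta>: "0 < \<delta>" "\<And>(n::nat) \<tau>. 
        \<tau> 0 = 0 \<and> \<tau> n = t \<and> (\<forall>i<n. \<tau> i \<le> \<tau> (Suc i) \<and> \<tau> (Suc i) - \<tau> i < \<delta>) \<Longrightarrow>
        (\<integral>\<^sup>+\<omega>. ennreal ((norm ((\<Sum>i<n. G (\<tau> i) *v (Z (\<tau> (Suc i)) \<omega> - Z (\<tau> i) \<omega>)) - I \<omega>))\<^sup>2) \<partial>M)
          < ennreal (e / 2)"
    using I e2 unfolding ito_integral_def Z_def by blast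
  obtain n where n: "t / \<delta> < real n" using reals_Archimedean2 by blast
  have n0: "0 < real n" using n t \<delta>(1) by (meson divide_nonneg_pos le_less_trans)
  define \<tau> where "\<tau> i = t * real i / real n" for i
  have \<tau>: "\<tau> 0 = 0" "\<tau> n = t" "\<And>i. \<tau> i \<le> \<tau> (Suc i)" "\<And>i. \<tau> (Suc i) - \<tau> i < \<delta>" "\<And>i. 0 \<le> \<tau> i"
    using n n0 t \<delta>(1) by (auto simp: \<tau>_def divide_simps algebra_simps)
  have \<tau>t: "\<tau> i \<le> t" if "i \<le> n" for i using partition_bounds(2)[of n \<tau> i] \<tau> that by auto
  have \<eta>: "0 \<le> \<eta>" using order_trans[OF norm_ge_zero G[of 0]] t by simp
  have h0: "0 \<le> h" using order_trans[OF norm_ge_zero h[of 0]] t by simp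
  define drift where "drift i = integral {0..\<tau> (Suc i)} (\<lambda>s. H *v X s) - integral {0..\<tau> i} (\<lambda>s. H *v X s)" for i
  define S1 where "S1 = (\<Sum>i<n. G (\<tau> i) *v drift i)"
  define S2 where "S2 \<omega> = (\<Sum>i<n. (G (\<tau> i) ** \<Gamma>h) *v (V (\<tau> (Suc i)) \<omega> - V (\<tau> i) \<omega>))" for \<omega>
  define S where "S \<omega> = (\<Sum>i<n. G (\<tau> i) *v (Z (\<tau> (Suc i)) \<omega> - Z (\<tau> i) \<omega>))" for \<omega>
  have S_split: "S \<omega> = S1 + S2 \<omega>" for \<omega>
  proof -
    have "Z (\<tau> (Suc i)) \<omega> - Z (\<tau> i) \<omega> = drift i + \<Gamma>h *v (V (\<tau> (Suc i)) \<omega> - V (\<tau> i) \<omega>)" for i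
      by (simp add: Z_def observation_def drift_def matrix_vector_mult_diff_distrib)
    then show ?thesis
      by (simp only: S_def S1_def S2_def matrix_vector_right_distrib matrix_vector_mul_assoc sum.distrib)
  qed
  have cHX: "continuous_on {0..} (\<lambda>s. H *v X s)"
    by (intro continuous_on_matrix_vector_mult continuous_on_const X)
  have drift: "norm (drift i) \<le> h * (\<tau> (Suc i) - \<tau> i)" if "i < n" for i
  proof -
    have "integral {0..\<tau> i} (\<lambda>s. H *v X s) + integral {\<tau> i..\<tau> (Suc i)} (\<lambda>s. H *v X s) = 
        integral {0..\<tau> (Suc i)} (\<lambda>s. H *v X s)"
      by (intro Henstock_Kurzweil_Integration.integral_combine \<tau> integrable_continuous_real
        continuous_on_subset[OF cHX]) auto
    then have "drift i = integral {\<tau> i..\<tau> (Suc i)} (\<lambda>s. H *v X s)" by (simp add: drift_def algebra_simps)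
    moreover have "norm \<dots> \<le> h * (\<tau> (Suc i) - \<tau> i)"
      using \<tau>t[of "Suc i"] that \<tau>(5)[of i]
      by (intro integral_bound \<tau> continuous_on_subset[OF cHX] h) auto
    ultimately show ?thesis by simp
  qed
  have "norm S1 \<le> (\<Sum>i<n. \<eta> * (h * (\<tau> (Suc i) - \<tau> i)))"
    unfolding S1_def
  proof (rule sum_norm_le)
    fix i assume "i \<in> {..<n}"
    then show "norm (G (\<tau> i) *v drift i) \<le> \<eta> * (h * (\<tau> (Suc i) - \<tau> i))"
      using G[of "\<tau> i"] \<tau>t[of i] \<tau>(5)[of i] drift[of i] \<eta>
      by (intro order_trans[OF norm_matrix_vector_mult_le] mult_mono) auto
  qed
  also have "\<dots> = \<eta> * (h * t)" by (simp add: sum_lessThan_telescope \<tau> flip: sum_distrib_left)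
  finally have "(norm S1)\<^sup>2 \<le> (\<eta> * (h * t))\<^sup>2" by (intro power_mono) auto
  then have S1: "(\<integral>\<^sup>+\<omega>. ennreal ((norm S1)\<^sup>2) \<partial>M) \<le> ennreal (\<eta>\<^sup>2 * (h * t)\<^sup>2)"
    by (simp add: emeasure_space_1 power_mult_distrib ennreal_leI)
  have S2: "(\<integral>\<^sup>+\<omega>. ennreal ((norm (S2 \<omega>))\<^sup>2) \<partial>M) \<le> ennreal ((\<eta> * norm \<Gamma>h)\<^sup>2 * (real CARD('k) * t))"
  proof -
    have "norm (G (\<tau> i) ** \<Gamma>h) \<le> \<eta> * norm \<Gamma>h" if "i < n" for i
      using G[of "\<tau> i"] \<tau>t[of i] \<tau>(5)[of i] that
      by (intro order_trans[OF norm_matrix_matrix_mult_le] mult_right_mono) auto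
    from brownian_sum_second_moment[OF V, of \<tau> n "\<lambda>i. G (\<tau> i) ** \<Gamma>h", OF _ _ this]
    show ?thesis using \<tau> by (simp add: S2_def)
  qed
  have [measurable]: "I \<in> borel_measurable M" by (rule ito_integral_measurable[OF I])
  have [measurable]: "S2 \<in> borel_measurable M" unfolding S2_def[abs_def]
    by (intro borel_measurable_sum borel_measurable_matrix_vector_mult borel_measurable_diff
        brownian_motion_measurable[OF V] \<tau>)
  have "(\<integral>\<^sup>+\<omega>. ennreal ((norm (I \<omega>))\<^sup>2) \<partial>M) = (\<integral>\<^sup>+\<omega>. ennreal ((norm ((I \<omega> - S \<omega>) + S \<omega>))\<^sup>2) \<partial>M)"
    by simp
  also have "\<dots> \<le> 2 * (\<integral>\<^sup>+\<omega>. ennreal ((norm (I \<omega> - S \<omega>))\<^sup>2) \<partial>M) + 2 * (\<integral>\<^sup>+\<omega>. ennreal ((norm (S \<omega>))\<^sup>2) \<partial>M)"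
    by (rule nn_integral_power2_norm_add_le) (simp_all add: S_split[abs_def])
  also have "\<dots> \<le> 2 * ennreal (e / 2) + 2 * (2 * ennreal (\<eta>\<^sup>2 * (h * t)\<^sup>2) + 2 * ennreal ((\<eta> * norm \<Gamma>h)\<^sup>2 * (real CARD('k) * t)))"
  proof (intro add_mono mult_left_mono)
    show "(\<integral>\<^sup>+\<omega>. ennreal ((norm (I \<omega> - S \<omega>))\<^sup>2) \<partial>M) \<le> ennreal (e / 2)"
      using \<delta>(2)[of \<tau> n] \<tau> by (simp add: norm_minus_commute less_imp_le S_def)
    have "(\<integral>\<^sup>+\<omega>. ennreal ((norm (S \<omega>))\<^sup>2) \<partial>M) \<le> 
      2 * (\<integral>\<^sup>+\<omega>. ennreal ((norm S1)\<^sup>2) \<partial>M) + 2 * (\<integral>\<^sup>+\<omega>. ennreal ((norm (S2 \<omega>))\<^sup>2) \<partial>M)"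
      unfolding S_split by (rule nn_integral_power2_norm_add_le) simp_all
    also have "\<dots> \<le> 2 * ennreal (\<eta>\<^sup>2 * (h * t)\<^sup>2) + 2 * ennreal ((\<eta> * norm \<Gamma>h)\<^sup>2 * (real CARD('k) * t))"
      by (intro add_mono mult_left_mono S1 S2) auto
    finally show "(\<integral>\<^sup>+\<omega>. ennreal ((norm (S \<omega>))\<^sup>2) \<partial>M) \<le> 
       2 * ennreal (\<eta>\<^sup>2 * (h * t)\<^sup>2) + 2 * ennreal ((\<eta> * norm \<Gamma>h)\<^sup>2 * (real CARD('k) * t))" .
  qed auto
  also have "\<dots> = ennreal (4 * \<eta>\<^sup>2 * ((h * t)\<^sup>2 + (norm \<Gamma>h)\<^sup>2 * (real CARD('k) * t)) + e)"
    using \<open>0 < e\<close> t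
    by (simp add: algebra_simps power_mult_distrib flip: ennreal_plus ennreal_mult ennreal_numeral)
  finally show "(\<integral>\<^sup>+\<omega>. ennreal ((norm (I \<omega>))\<^sup>2) \<partial>M) \<le>
    ennreal (4 * \<eta>\<^sup>2 * ((h * t)\<^sup>2 + (norm \<Gamma>h)\<^sup>2 * (real CARD('k) * t))) + ennreal e"
    using \<open>0 < e\<close> t by (simp flip: ennreal_plus)
qed

section \<open>From pathwise growth to moment bounds\<close>

lemma riemann_sums_tendsto_integral:
  fixes f :: "real \<Rightarrow> real"
  assumes f: "continuous_on {0..T} f" and "0 \<le> T"
  shows "(\<lambda>n. T / real (Suc n) * (\<Sum>i<Suc n. f (T * real i / real (Suc n)))) \<longlonglongrightarrow> integral {0..T} f"
proof (rule LIMSEQ_I)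
  fix e :: real assume "0 < e"
  define e' where "e' = e / (T + 1)"
  have e': "0 < e'" using \<open>0 < e\<close> \<open>0 \<le> T\<close> by (simp add: e'_def)
  obtain \<delta> where \<delta>: "0 < \<delta>"
    "\<And>x z. x \<in> {0..T} \<Longrightarrow> z \<in> {0..T} \<Longrightarrow> dist z x < \<delta> \<Longrightarrow> dist (f z) (f x) < e'"
    using compact_uniformly_continuous[OF f] e' unfolding uniformly_continuous_on_def by (metis compact_Icc)
  obtain n0 where n0: "T / \<delta> < real n0" using reals_Archimedean2 by blast
  have "norm (T / real (Suc n) * (\<Sum>i<Suc n. f (T * real i / real (Suc n))) - integral {0..T} f) < e"
    if "n0 \<le> n" for n
  proof -
    define N where "N = real (Suc n)"
    define w where "w = T / N"
    have N: "0 < N" by (simp add: N_def)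
    have w: "0 \<le> w" "w < \<delta>" "w * N = T"
    proof -
      have "T / \<delta> < N" using n0 that by (simp add: N_def)
      then show "w < \<delta>" using N \<delta>(1) by (simp add: w_def field_simps)
    qed (use N \<open>0 \<le> T\<close> in \<open>simp_all add: w_def\<close>)
    have partial: "\<bar>integral {0..w * real k} f - w * (\<Sum>i<k. f (w * real i))\<bar> \<le> e' * (w * real k)"
      if "k \<le> Suc n" for k using that
    proof (induction k)
      case (Suc k)
      let ?x = "w * real k" and ?z = "w * real (Suc k)"
      have le: "0 \<le> ?x" "?x \<le> ?z" "?z \<le> T"
        using w N Suc.prems by (auto simp: mult_left_mono N_def simp flip: w(3))
      have sub: "continuous_on {?x..?z} f" using le by (intro continuous_on_subset[OF f]) auto
      have "integral {0..?x} f + integral {?x..?z} f = integral {0..?z} f"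
        using le by (intro Henstock_Kurzweil_Integration.integral_combine integrable_continuous_real 
            continuous_on_subset[OF f]) auto
      moreover have "integral {?x..?z} (\<lambda>s. f s - f ?x) = integral {?x..?z} f - w * f ?x"
        using w(1) Henstock_Kurzweil_Integration.integral_diff[OF integrable_continuous_real[OF sub] integrable_const_ivl]
        by (simp add: distrib_left)
      moreover have "norm (integral {?x..?z} (\<lambda>s. f s - f ?x)) \<le> e' * (?z - ?x)"
      proof (rule integral_bound)
        fix s assume s: "s \<in> {?x..?z}"
        have "?z - ?x = w" by (simp add: algebra_simps)
        then have "dist s ?x < \<delta>" using s w by (auto simp: dist_real_def)
        then show "norm (f s - f ?x) \<le> e'" using \<delta>(2)[of ?x s] s le by (auto simp: dist_real_def)
      qed (use le sub in \<open>auto intro!: continuous_intros\<close>)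
      ultimately show ?case using Suc by (simp add: algebra_simps abs_le_iff)
    qed simp
    from partial[of "Suc n"] have "\<bar>integral {0..T} f - w * (\<Sum>i<Suc n. f (w * real i))\<bar> \<le> e' * T"
      using w(3) by (simp add: N_def)
    also have "\<dots> < e" using \<open>0 < e\<close> \<open>0 \<le> T\<close> by (simp add: e'_def field_simps)
    finally show ?thesis by (simp add: w_def N_def abs_minus_commute)
  qed
  then show "\<exists>n0. \<forall>n\<ge>n0. norm (T / real (Suc n) * (\<Sum>i<Suc n. f (T * real i / real (Suc n))) - integral {0..T} f) < e"
    by blast
qed

text \<open>Gronwall's inequality is applied to each path, which is bounded on compact time intervals by continuity, so no moment of \<open>y\<close> has to be known finite
beforehand. The resulting time integral of \<open>a\<close> is replaced by Riemann sums: each of these involves finitely many times only,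
and Fatou's lemma controls the limit. This is why the hypotheses on measurability,
on the moments and on the agreement of \<open>a t\<close> with a random variable \<open>g t\<close> are stated for each time separately.\<close>
lemma moment_gronwall:
  fixes y a g :: "real \<Rightarrow> 'w \<Rightarrow> real"
  assumes "0 \<le> b" "0 \<le> T" "0 \<le> K"
    and y: "AE \<omega> in M. continuous_on {0..T} (\<lambda>t. y t \<omega>)"
    and a: "AE \<omega> in M. continuous_on {0..T} (\<lambda>t. a t \<omega>)"
    and nonneg: "AE \<omega> in M. \<forall>t\<in>{0..T}. 0 \<le> y t \<omega> \<and> 0 \<le> a t \<omega>"
    and le: "AE \<omega> in M. \<forall>t\<in>{0..T}. y t \<omega> \<le> a t \<omega> + b * integral {0..t} (\<lambda>s. y s \<omega>)"
    and g: "\<And>t. t \<in> {0..T} \<Longrightarrow> g t \<in> borel_measurable M"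
    and ag: "\<And>t. t \<in> {0..T} \<Longrightarrow> AE \<omega> in M. a t \<omega> = g t \<omega>"
    and moment: "\<And>t. t \<in> {0..T} \<Longrightarrow> (\<integral>\<^sup>+\<omega>. ennreal ((g t \<omega>)\<^sup>2) \<partial>M) \<le> ennreal K"
  shows "(\<integral>\<^sup>+\<omega>. ennreal ((y T \<omega>)\<^sup>2) \<partial>M) \<le> ennreal (2 * (1 + (b * exp (b * T) * T)\<^sup>2) * K)"
proof -
  define c where "c = b * exp (b * T)"
  have c: "0 \<le> c" using \<open>0 \<le> b\<close> by (simp add: c_def)
  define x where "x n i = T * real i / real (Suc n)" for n i
  have x: "x n i \<in> {0..T}" if "i < Suc n" for n i
  proof -
    have "T * real i \<le> T * real (Suc n)" using that \<open>0 \<le> T\<close> by (intro mult_left_mono) auto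
    then show ?thesis using \<open>0 \<le> T\<close> by (simp add: x_def divide_simps)
  qed
  have T: "T \<in> {0..T}" using \<open>0 \<le> T\<close> by simp
  \<comment> \<open>The square of the Gronwall bound, with the integral of \<open>a\<close> replaced by its Riemann sum.\<close>
  define W where "W n \<omega> = 2 * (g T \<omega>)\<^sup>2 + 2 * c\<^sup>2 * (T / real (Suc n) * (\<Sum>i<Suc n. g (x n i) \<omega>))\<^sup>2" for n \<omega>
  have "AE \<omega> in M. \<forall>n i. i < Suc n \<longrightarrow> a (x n i) \<omega> = g (x n i) \<omega>"
    unfolding AE_all_countable using ag x by (auto intro: AE_I2 AE_impI)
  with y a nonneg le ag[OF T] have "AE \<omega> in M. ennreal ((y T \<omega>)\<^sup>2) \<le> liminf (\<lambda>n. ennreal (W n \<omega>))"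
  proof eventually_elim
    case (elim \<omega>)
    define A where "A = integral {0..T} (\<lambda>s. a s \<omega>)"
    have A: "0 \<le> A" unfolding A_def using elim(2,3)
      by (intro Henstock_Kurzweil_Integration.integral_nonneg integrable_continuous_real) auto
    have "y T \<omega> \<le> a T \<omega> + c * A"
      unfolding c_def A_def using elim \<open>0 \<le> b\<close> \<open>0 \<le> T\<close> by (intro integral_gronwall) auto
    then have "(y T \<omega>)\<^sup>2 \<le> (a T \<omega> + c * A)\<^sup>2" using elim(3) T by (intro power_mono) auto
    also have "\<dots> \<le> 2 * (a T \<omega>)\<^sup>2 + 2 * c\<^sup>2 * A\<^sup>2"
      using sum_squares_bound[of "a T \<omega>" "c * A"] by (simp add: power2_sum power_mult_distrib mult_ac add.commute)
    finally have "(y T \<omega>)\<^sup>2 \<le> 2 * (g T \<omega>)\<^sup>2 + 2 * c\<^sup>2 * A\<^sup>2" using elim(5) by simp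
    moreover have "(\<lambda>n. W n \<omega>) \<longlonglongrightarrow> 2 * (g T \<omega>)\<^sup>2 + 2 * c\<^sup>2 * A\<^sup>2"
    proof -
      have "(\<lambda>n. T / real (Suc n) * (\<Sum>i<Suc n. a (x n i) \<omega>)) \<longlonglongrightarrow> A"
        unfolding x_def A_def by (rule riemann_sums_tendsto_integral[OF elim(2) \<open>0 \<le> T\<close>])
      then have "(\<lambda>n. 2 * (g T \<omega>)\<^sup>2 + 2 * c\<^sup>2 * (T / real (Suc n) * (\<Sum>i<Suc n. a (x n i) \<omega>))\<^sup>2) 
          \<longlonglongrightarrow> 2 * (g T \<omega>)\<^sup>2 + 2 * c\<^sup>2 * A\<^sup>2"
        by (intro tendsto_intros)
      moreover have "(\<Sum>i<Suc n. a (x n i) \<omega>) = (\<Sum>i<Suc n. g (x n i) \<omega>)" for n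
        using elim(6) by (intro sum.cong) auto
      ultimately show ?thesis by (simp only: W_def)
    qed
    then have "(\<lambda>n. ennreal (W n \<omega>)) \<longlonglongrightarrow> ennreal (2 * (g T \<omega>)\<^sup>2 + 2 * c\<^sup>2 * A\<^sup>2)"
      by (rule tendsto_ennrealI)
    ultimately show ?case by (metis ennreal_leI lim_imp_Liminf sequentially_bot)
  qed
  then have "(\<integral>\<^sup>+\<omega>. ennreal ((y T \<omega>)\<^sup>2) \<partial>M) \<le> (\<integral>\<^sup>+\<omega>. liminf (\<lambda>n. ennreal (W n \<omega>)) \<partial>M)"
    by (rule nn_integral_mono_AE)
  also have "\<dots> \<le> liminf (\<lambda>n. \<integral>\<^sup>+\<omega>. ennreal (W n \<omega>) \<partial>M)"
  proof (rule nn_integral_liminf)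
    fix n
    have "(\<lambda>\<omega>. \<Sum>i<Suc n. g (x n i) \<omega>) \<in> borel_measurable M"
      by (intro borel_measurable_sum g x) auto
    with g[OF T] show "(\<lambda>\<omega>. ennreal (W n \<omega>)) \<in> borel_measurable M" unfolding W_def by measurable
  qed
  also have "\<dots> \<le> ennreal (2 * (1 + (c * T)\<^sup>2) * K)"
  proof (rule Liminf_le)
    have "(\<integral>\<^sup>+\<omega>. ennreal (W n \<omega>) \<partial>M) \<le> ennreal (2 * (1 + (c * T)\<^sup>2) * K)" for n
    proof -
      \<comment> \<open>Cauchy-Schwarz for the sum gains back the number of its terms, so the bound does not depend on \<open>n\<close>.\<close>
      define q where "q = 2 * c\<^sup>2 * T\<^sup>2 / real (Suc n)"
      have q: "0 \<le> q" by (simp add: q_def)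
      have W: "W n \<omega> \<le> 2 * (g T \<omega>)\<^sup>2 + q * (\<Sum>i<Suc n. (g (x n i) \<omega>)\<^sup>2)" for \<omega>
      proof -
        have "(\<Sum>i<Suc n. g (x n i) \<omega>)\<^sup>2 \<le> (\<Sum>i<Suc n. (g (x n i) \<omega>)\<^sup>2) * real (Suc n)"
          using sum_squared_le_sum_of_squares[of "\<lambda>i. g (x n i) \<omega>" "{..<Suc n}"] by simp
        then have "2 * c\<^sup>2 * (T / real (Suc n))\<^sup>2 * (\<Sum>i<Suc n. g (x n i) \<omega>)\<^sup>2 \<le>
          2 * c\<^sup>2 * (T / real (Suc n))\<^sup>2 * ((\<Sum>i<Suc n. (g (x n i) \<omega>)\<^sup>2) * real (Suc n))"
          by (intro mult_left_mono) auto
        also have "\<dots> = q * (\<Sum>i<Suc n. (g (x n i) \<omega>)\<^sup>2)"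
          unfolding q_def by (simp add: power_divide power2_eq_square del: sum.lessThan_Suc of_nat_Suc)
        finally show ?thesis
          by (simp only: W_def power_mult_distrib[of "T / real (Suc n)"] mult.assoc add_le_cancel_left)
      qed
      have meas: "(\<lambda>\<omega>. ennreal ((g t \<omega>)\<^sup>2)) \<in> borel_measurable M" if "t \<in> {0..T}" for t
        using g[OF that] by measurable
      have "(\<integral>\<^sup>+\<omega>. ennreal (W n \<omega>) \<partial>M) \<le>
        (\<integral>\<^sup>+\<omega>. (2 * ennreal ((g T \<omega>)\<^sup>2) + ennreal q * (\<Sum>i<Suc n. ennreal ((g (x n i) \<omega>)\<^sup>2))) \<partial>M)"
      proof (rule nn_integral_mono)
        fix \<omega>
        have "ennreal (W n \<omega>) \<le> ennreal (2 * (g T \<omega>)\<^sup>2 + q * (\<Sum>i<Suc n. (g (x n i) \<omega>)\<^sup>2))"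
          by (rule ennreal_leI[OF W])
        also have "\<dots> = 2 * ennreal ((g T \<omega>)\<^sup>2) + ennreal q * (\<Sum>i<Suc n. ennreal ((g (x n i) \<omega>)\<^sup>2))"
          using q by (subst sum_ennreal) (auto simp: ennreal_plus ennreal_mult sum_nonneg simp del: sum.lessThan_Suc)
        finally show "ennreal (W n \<omega>) \<le> 2 * ennreal ((g T \<omega>)\<^sup>2) + ennreal q * (\<Sum>i<Suc n. ennreal ((g (x n i) \<omega>)\<^sup>2))" .
      qed
      also have "\<dots> = 2 * (\<integral>\<^sup>+\<omega>. ennreal ((g T \<omega>)\<^sup>2) \<partial>M) + 
          ennreal q * (\<Sum>i<Suc n. \<integral>\<^sup>+\<omega>. ennreal ((g (x n i) \<omega>)\<^sup>2) \<partial>M)"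
      proof -
        have s: "(\<lambda>\<omega>. \<Sum>i<Suc n. ennreal ((g (x n i) \<omega>)\<^sup>2)) \<in> borel_measurable M"
          by (intro borel_measurable_sum meas x) auto
        have "(\<integral>\<^sup>+\<omega>. (\<Sum>i<Suc n. ennreal ((g (x n i) \<omega>)\<^sup>2)) \<partial>M) = 
           (\<Sum>i<Suc n. \<integral>\<^sup>+\<omega>. ennreal ((g (x n i) \<omega>)\<^sup>2) \<partial>M)"
          by (intro nn_integral_sum meas x) auto
        then show ?thesis using s meas[OF T]
          by (simp add: nn_integral_add nn_integral_cmult del: sum.lessThan_Suc)
      qed
      also have "\<dots> \<le> 2 * ennreal K + ennreal q * (\<Sum>i<Suc n. ennreal K)"
        by (intro add_mono mult_left_mono sum_mono moment x T) auto
      also have "\<dots> = ennreal (2 * K + q * (real (Suc n) * K))"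
        using q \<open>0 \<le> K\<close> by (subst sum_ennreal) (auto simp: ennreal_plus ennreal_mult simp del: sum.lessThan_Suc of_nat_Suc)
      also have "2 * K + q * (real (Suc n) * K) = 2 * (1 + (c * T)\<^sup>2) * K"
        by (simp add: q_def power_mult_distrib algebra_simps del: of_nat_Suc)
      finally show ?thesis .
    qed
    then show "\<forall>\<^sub>F n in sequentially. (\<integral>\<^sup>+\<omega>. ennreal (W n \<omega>) \<partial>M) \<le> ennreal (2 * (1 + (c * T)\<^sup>2) * K)"
      by simp
  qed simp
  finally show ?thesis by (simp add: c_def)
qed

section \<open>The difference of the means\<close>

text \<open>What remains of the mean after its initial value and drift are subtracted. It equals the stochastic integral almost surely
at each fixed time, but unlike a version of that integral it is defined by the path and inherits its continuity.\<close>
definition mean_residual ::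
  "real ^ 'd ^ 'd \<Rightarrow> real ^ 'd ^ 'd \<Rightarrow> real ^ 'd \<Rightarrow> (real \<Rightarrow> real ^ 'd ^ 'd) \<Rightarrow> (real \<Rightarrow> 'w \<Rightarrow> real ^ 'd)
     \<Rightarrow> real \<Rightarrow> 'w \<Rightarrow> real ^ 'd" where
  "mean_residual A S f P m t \<omega> =
     m t \<omega> - m 0 \<omega> - integral {0..t} (\<lambda>s. (A - P s ** S) *v m s \<omega> + f)"

lemma mean_residual_ito:
  assumes "mean_solution M A f H \<Gamma> Z P m" "0 \<le> t"
  obtains I where "ito_integral M (\<lambda>s. kalman_gain H \<Gamma> (P s)) Z t I"
    "AE \<omega> in M. mean_residual A (obs_info H \<Gamma>) f P m t \<omega> = I \<omega>"
proof -
  have drift: "A *v x + f - kalman_gain H \<Gamma> (P s) *v (H *v x) = (A - P s ** obs_info H \<Gamma>) *v x + f" for s x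
    by (simp add: kalman_gain_mult matrix_vector_mult_diff_rdistrib)
  obtain I where I: "ito_integral M (\<lambda>s. kalman_gain H \<Gamma> (P s)) Z t I"
    and eq: "AE \<omega> in M. m t \<omega> = m 0 \<omega> +
           integral {0..t} (\<lambda>s. (A - P s ** obs_info H \<Gamma>) *v m s \<omega> + f) + I \<omega>"
    using assms unfolding mean_solution_def drift by blast
  show ?thesis
    by (rule that[OF I]) (use eq in eventually_elim, simp add: mean_residual_def)
qed

lemma mean_solution_continuous:
  assumes "mean_solution M A f H \<Gamma> Z P m"
  shows "AE \<omega> in M. continuous_on {0..T} (\<lambda>t. m t \<omega>)"
proof -
  have "AE \<omega> in M. continuous_on {0..} (\<lambda>t. m t \<omega>)" using assms by (simp add: mean_solution_def)
  then show ?thesis by eventually_elim (auto elim: continuous_on_subset)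
qed

lemma continuous_on_mean_drift:
  fixes A S :: "real ^ 'd ^ 'd" and m :: "real \<Rightarrow> 'w \<Rightarrow> real ^ 'd"
  assumes "continuous_on {0..T} P" "continuous_on {0..T} (\<lambda>t. m t \<omega>)"
  shows "continuous_on {0..T} (\<lambda>s. (A - P s ** S) *v m s \<omega> + f)"
  by (intro continuous_on_add continuous_on_const continuous_on_matrix_vector_mult
      continuous_on_diff continuous_on_matrix_matrix_mult assms)

lemma continuous_on_mean_residual:
  fixes A S :: "real ^ 'd ^ 'd" and m :: "real \<Rightarrow> 'w \<Rightarrow> real ^ 'd"
  assumes "continuous_on {0..T} P" "continuous_on {0..T} (\<lambda>t. m t \<omega>)"
  shows "continuous_on {0..T} (\<lambda>t. mean_residual A S f P m t \<omega>)"
  unfolding mean_residual_def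
  by (intro continuous_on_diff continuous_on_const assms indefinite_integral_continuous_1
      integrable_continuous_real continuous_on_mean_drift)

text \<open>The drift of the difference contains \<open>(PD - PK) S mK\<close>, of size \<open>\<eta> \<parallel>S\<parallel> \<parallel>mK\<parallel>\<close>. Adding \<open>\<eta>\<close> times the integral inequality for
\<open>\<parallel>mK\<parallel>\<close> closes the estimate in the single quantity \<open>\<parallel>mD - mK\<parallel> + \<eta> \<parallel>mK\<parallel>\<close>.\<close>
lemma mean_difference_growth:
  fixes A S :: "real ^ 'd ^ 'd" and f :: "real ^ 'd" and mK mD :: "real \<Rightarrow> 'w \<Rightarrow> real ^ 'd"
  assumes P: "continuous_on {0..T} PK" "continuous_on {0..T} PD"
    and m: "continuous_on {0..T} (\<lambda>t. mK t \<omega>)" "continuous_on {0..T} (\<lambda>t. mD t \<omega>)"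
    and p: "\<And>t. t \<in> {0..T} \<Longrightarrow> norm (PK t) \<le> p" "\<And>t. t \<in> {0..T} \<Longrightarrow> norm (PD t) \<le> p"
    and \<eta>: "\<And>t. t \<in> {0..T} \<Longrightarrow> norm (PD t - PK t) \<le> \<eta>"
    and t: "t \<in> {0..T}"
  defines "JK \<equiv> mean_residual A S f PK mK" and "JD \<equiv> mean_residual A S f PD mD"
  shows "norm (mD t \<omega> - mK t \<omega>) + \<eta> * norm (mK t \<omega>) \<le>
    norm (mD 0 \<omega> - mK 0 \<omega>) + norm (JD t \<omega> - JK t \<omega>) +
      \<eta> * norm (mK 0 \<omega>) + \<eta> * (norm f * T) + \<eta> * norm (JK t \<omega>) +
    (norm A + p * norm S + norm S) * integral {0..t} (\<lambda>s. norm (mD s \<omega> - mK s \<omega>) + \<eta> * norm (mK s \<omega>))"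
proof -
  define b where "b = norm A + p * norm S"
  define v where "v s = norm (mD s \<omega> - mK s \<omega>) + \<eta> * norm (mK s \<omega>)" for s
  define FK where "FK s = (A - PK s ** S) *v mK s \<omega> + f" for s
  define FD where "FD s = (A - PD s ** S) *v mD s \<omega> + f" for s
  have \<eta>0: "0 \<le> \<eta>" using order_trans[OF norm_ge_zero \<eta>[OF t]] .
  have sub: "{0..t} \<subseteq> {0..T}" using t by auto
  have cF: "continuous_on {0..t} FK" "continuous_on {0..t} FD"
    unfolding FK_def FD_def by (intro continuous_on_subset[OF _ sub] continuous_on_mean_drift P m)+
  have c: "continuous_on {0..t} (\<lambda>s. mK s \<omega>)" "continuous_on {0..t} (\<lambda>s. mD s \<omega>)"
    using m sub by (auto intro: continuous_on_subset)
  have cv: "continuous_on {0..t} v" unfolding v_def by (intro continuous_intros c)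
  have op: "norm ((A - P ** S) *v x) \<le> b * norm x" if "norm P \<le> p" for P x
  proof -
    have "norm (P ** S) \<le> p * norm S"
      by (rule order_trans[OF norm_matrix_matrix_mult_le]) (intro mult_right_mono that norm_ge_zero)
    then have "norm (A - P ** S) \<le> b" using norm_triangle_ineq4[of A "P ** S"] by (simp add: b_def)
    then show ?thesis by (intro order_trans[OF norm_matrix_vector_mult_le] mult_right_mono) auto
  qed
  have FK: "norm (FK s) \<le> b * norm (mK s \<omega>) + norm f" if "s \<in> {0..t}" for s
    using norm_triangle_ineq[of "(A - PK s ** S) *v mK s \<omega>" f] op[OF p(1), of s "mK s \<omega>"] that sub
    by (auto simp: FK_def)
  have FDK: "norm (FD s - FK s) \<le> b * norm (mD s \<omega> - mK s \<omega>) + \<eta> * norm S * norm (mK s \<omega>)"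
    if "s \<in> {0..t}" for s
  proof -
    have s: "s \<in> {0..T}" using that sub by auto
    have "FD s - FK s = (A - PD s ** S) *v (mD s \<omega> - mK s \<omega>) - ((PD s - PK s) ** S) *v mK s \<omega>"
      by (simp add: FD_def FK_def matrix_vector_mult_diff_distrib matrix_vector_mult_diff_rdistrib matrix_mult_diff_left)
    moreover have "norm (((PD s - PK s) ** S) *v mK s \<omega>) \<le> \<eta> * norm S * norm (mK s \<omega>)"
      by (intro order_trans[OF norm_matrix_vector_mult_le] mult_right_mono norm_ge_zero
          order_trans[OF norm_matrix_matrix_mult_le] \<eta> s)
    ultimately show ?thesis
      using norm_triangle_ineq4[of "(A - PD s ** S) *v (mD s \<omega> - mK s \<omega>)" "((PD s - PK s) ** S) *v mK s \<omega>"]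
        op[OF p(2)[OF s], of "mD s \<omega> - mK s \<omega>"] by simp
  qed
  have "norm (integral {0..t} FK) \<le> integral {0..t} (\<lambda>s. b * norm (mK s \<omega>) + norm f)"
    by (rule integral_norm_bound_integral[OF _ _ FK])
      (intro integrable_continuous_real cF continuous_intros c)+
  also have "\<dots> = b * integral {0..t} (\<lambda>s. norm (mK s \<omega>)) + norm f * t"
    using t by (subst Henstock_Kurzweil_Integration.integral_add) 
      (auto intro!: integrable_continuous_real continuous_intros c)
  also have "\<dots> \<le> b * integral {0..t} (\<lambda>s. norm (mK s \<omega>)) + norm f * T"
    using t by (intro add_left_mono mult_left_mono) auto
  finally have IK: "norm (integral {0..t} FK) \<le> b * integral {0..t} (\<lambda>s. norm (mK s \<omega>)) + norm f * T" .
  have "norm (integral {0..t} (\<lambda>s. FD s - FK s)) \<le>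
      integral {0..t} (\<lambda>s. b * norm (mD s \<omega> - mK s \<omega>) + \<eta> * norm S * norm (mK s \<omega>))"
    by (rule integral_norm_bound_integral[OF _ _ FDK])
      (intro integrable_continuous_real cF continuous_intros c)+
  then have IDK: "norm (integral {0..t} FD - integral {0..t} FK) \<le>
      integral {0..t} (\<lambda>s. b * norm (mD s \<omega> - mK s \<omega>) + \<eta> * norm S * norm (mK s \<omega>))"
    using cF by (simp add: Henstock_Kurzweil_Integration.integral_diff integrable_continuous_real)
  have mKt: "mK t \<omega> = mK 0 \<omega> + integral {0..t} FK + JK t \<omega>"
    by (simp add: JK_def mean_residual_def FK_def[abs_def])
  have mDt: "mD t \<omega> - mK t \<omega> = (mD 0 \<omega> - mK 0 \<omega>) + (integral {0..t} FD - integral {0..t} FK) + (JD t \<omega> - JK t \<omega>)"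
    by (simp add: JK_def JD_def mean_residual_def FK_def[abs_def] FD_def[abs_def])
  have "norm (mK t \<omega>) \<le> norm (mK 0 \<omega>) + norm (integral {0..t} FK) + norm (JK t \<omega>)"
    unfolding mKt by (intro order_trans[OF norm_triangle_ineq] add_right_mono norm_triangle_ineq)
  with IK have "\<eta> * norm (mK t \<omega>) \<le>
    \<eta> * (norm (mK 0 \<omega>) + (b * integral {0..t} (\<lambda>s. norm (mK s \<omega>)) + norm f * T) + norm (JK t \<omega>))"
    using \<eta>0 by (intro mult_left_mono) auto
  moreover have "norm (mD t \<omega> - mK t \<omega>) \<le> norm (mD 0 \<omega> - mK 0 \<omega>) +
      norm (integral {0..t} FD - integral {0..t} FK) + norm (JD t \<omega> - JK t \<omega>)"
    unfolding mDt by (intro order_trans[OF norm_triangle_ineq] add_right_mono norm_triangle_ineq)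
  moreover have "integral {0..t} (\<lambda>s. b * norm (mD s \<omega> - mK s \<omega>) + \<eta> * norm S * norm (mK s \<omega>)) +
      \<eta> * (b * integral {0..t} (\<lambda>s. norm (mK s \<omega>))) \<le> (b + norm S) * integral {0..t} v"
  proof -
    have "integral {0..t} (\<lambda>s. b * norm (mD s \<omega> - mK s \<omega>) + \<eta> * norm S * norm (mK s \<omega>)) +
      \<eta> * (b * integral {0..t} (\<lambda>s. norm (mK s \<omega>))) =
      integral {0..t} (\<lambda>s. (b * norm (mD s \<omega> - mK s \<omega>) + \<eta> * norm S * norm (mK s \<omega>)) + \<eta> * b * norm (mK s \<omega>))"
      by (subst (2) Henstock_Kurzweil_Integration.integral_add)
        (auto intro!: integrable_continuous_real continuous_intros c simp: mult.assoc)
    also have "\<dots> \<le> integral {0..t} (\<lambda>s. (b + norm S) * v s)"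
    proof (rule integral_le)
      fix s assume "s \<in> {0..t}"
      have "0 \<le> norm S * norm (mD s \<omega> - mK s \<omega>)" by simp
      then show "(b * norm (mD s \<omega> - mK s \<omega>) + \<eta> * norm S * norm (mK s \<omega>)) + \<eta> * b * norm (mK s \<omega>) \<le> (b + norm S) * v s"
        by (simp add: v_def algebra_simps)
    qed (intro integrable_continuous_real continuous_intros c cv)+
    also have "\<dots> = (b + norm S) * integral {0..t} v" by simp
    finally show ?thesis .
  qed
  ultimately show ?thesis using IDK by (simp add: b_def v_def[abs_def] algebra_simps)
qed

lemma power2_sum5_le:
  fixes x :: real
  shows "(x + y + z + u + v)\<^sup>2 \<le> 5 * x\<^sup>2 + 5 * y\<^sup>2 + 5 * z\<^sup>2 + 5 * u\<^sup>2 + 5 * v\<^sup>2"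
proof -
  have "0 \<le> (x-y)\<^sup>2 + (x-z)\<^sup>2 + (x-u)\<^sup>2 + (x-v)\<^sup>2 + (y-z)\<^sup>2 + (y-u)\<^sup>2 + (y-v)\<^sup>2 + (z-u)\<^sup>2 + (z-v)\<^sup>2 + (u-v)\<^sup>2"
    by (intro add_nonneg_nonneg zero_le_power2)
  then show ?thesis by (simp add: power2_eq_square algebra_simps)
qed

text \<open>The factor in the bound for \<open>\<integral> P H\<^sup>T \<Gamma>\<^sup>-\<^sup>1 dZ\<close>, with \<open>h\<close> a bound for \<open>\<parallel>H X\<parallel>\<close> on \<open>[0, T]\<close>.\<close>
definition noise_constant ::
  "real ^ 'd ^ 'k \<Rightarrow> real ^ 'k ^ 'k \<Rightarrow> real ^ 'k ^ 'k \<Rightarrow> real \<Rightarrow> real \<Rightarrow> real" where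
  "noise_constant H \<Gamma> \<Gamma>h h T = 4 * (norm (transpose H ** matrix_inv \<Gamma>))\<^sup>2 *
     ((h * T)\<^sup>2 + (norm \<Gamma>h)\<^sup>2 * (real CARD('k) * T))"

lemma kalman_noise_second_moment:
  fixes H :: "real ^ 'd ^ 'k"
  assumes V: "brownian_motion M V" and X: "continuous_on {0..} X"
    and I: "ito_integral M (\<lambda>s. kalman_gain H \<Gamma> (P s)) (observation H \<Gamma>h X V) t I"
    and t: "t \<in> {0..T}" and q: "\<And>s. s \<in> {0..T} \<Longrightarrow> norm (P s) \<le> q"
    and h: "\<And>s. s \<in> {0..T} \<Longrightarrow> norm (H *v X s) \<le> h"
  shows "(\<integral>\<^sup>+\<omega>. ennreal ((norm (I \<omega>))\<^sup>2) \<partial>M) \<le> ennreal (noise_constant H \<Gamma> \<Gamma>h h T * q\<^sup>2)"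
proof -
  let ?\<gamma> = "norm (transpose H ** matrix_inv \<Gamma>)"
  have "norm (kalman_gain H \<Gamma> (P s)) \<le> q * ?\<gamma>" if "s \<in> {0..t}" for s
  proof -
    have "norm (P s ** (transpose H ** matrix_inv \<Gamma>)) \<le> q * ?\<gamma>"
      using that t by (intro order_trans[OF norm_matrix_matrix_mult_le] mult_right_mono q) auto
    then show ?thesis by (simp add: kalman_gain_def matrix_mul_assoc)
  qed
  then have "(\<integral>\<^sup>+\<omega>. ennreal ((norm (I \<omega>))\<^sup>2) \<partial>M) \<le>
      ennreal (4 * (q * ?\<gamma>)\<^sup>2 * ((h * t)\<^sup>2 + (norm \<Gamma>h)\<^sup>2 * (real CARD('k) * t)))"
    using t h by (intro ito_integral_second_moment[OF V X I]) auto
  also have "\<dots> \<le> ennreal (4 * (q * ?\<gamma>)\<^sup>2 * ((h * T)\<^sup>2 + (norm \<Gamma>h)\<^sup>2 * (real CARD('k) * T)))"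
    using t order_trans[OF norm_ge_zero h[OF t]]
    by (intro ennreal_leI mult_left_mono add_mono power_mono) auto
  finally show ?thesis by (simp add: noise_constant_def power_mult_distrib mult_ac)
qed

text \<open>Here \<open>c\<close> is the noise constant, \<open>p\<close> bounds both covariances and \<open>\<rho>\<close> bounds the second moment of the initial Kalman-Bucy mean.\<close>
definition mean_constant :: "real ^ 'd ^ 'd \<Rightarrow> real ^ 'd ^ 'd \<Rightarrow> real ^ 'd \<Rightarrow> real \<Rightarrow> real \<Rightarrow> real \<Rightarrow> real \<Rightarrow> real" where
  "mean_constant A S f c p \<rho> T =
    (let b = norm A + p * norm S + norm S in
     2 * (1 + (b * exp (b * T) * T)\<^sup>2) * (5 * (1 + c + \<rho> + (norm f * T)\<^sup>2 + c * p\<^sup>2)))"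

text \<open>Each contribution to the forcing in the pathwise inequality is, in mean square, at most a constant times \<open>D + \<eta>\<^sup>2\<close>: the noise
in the difference has an integrand of size \<open>\<eta>\<close>, and all terms of \<open>mK\<close> come with the weight \<open>\<eta>\<close>.\<close>
lemma mean_difference_second_moment:
  fixes H :: "real ^ 'd ^ 'k" and V :: "real \<Rightarrow> 'w \<Rightarrow> real ^ 'k"
  assumes V: "brownian_motion M V" and X: "continuous_on {0..} X"
    and mK: "mean_solution M A f H \<Gamma> (observation H \<Gamma>h X V) PK mK"
    and mD: "mean_solution M A f H \<Gamma> (observation H \<Gamma>h X V) PD mD"
    and P: "continuous_on {0..T} PK" "continuous_on {0..T} PD"
    and p: "\<And>t. t \<in> {0..T} \<Longrightarrow> norm (PK t) \<le> p" "\<And>t. t \<in> {0..T} \<Longrightarrow> norm (PD t) \<le> p"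
    and \<eta>: "\<And>t. t \<in> {0..T} \<Longrightarrow> norm (PD t - PK t) \<le> \<eta>"
    and h: "\<And>s. s \<in> {0..T} \<Longrightarrow> norm (H *v X s) \<le> h"
    and "0 \<le> T" and "0 \<le> D" "0 \<le> \<rho>"
    and D: "(\<integral>\<^sup>+\<omega>. ennreal ((norm (mD 0 \<omega> - mK 0 \<omega>))\<^sup>2) \<partial>M) \<le> ennreal D"
    and \<rho>: "(\<integral>\<^sup>+\<omega>. ennreal ((norm (mK 0 \<omega>))\<^sup>2) \<partial>M) \<le> ennreal \<rho>"
  shows "(\<integral>\<^sup>+\<omega>. ennreal ((norm (mD T \<omega> - mK T \<omega>))\<^sup>2) \<partial>M) \<le>
    ennreal (mean_constant A (obs_info H \<Gamma>) f (noise_constant H \<Gamma> \<Gamma>h h T) p \<rho> T * (D + \<eta>\<^sup>2))"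
proof -
  interpret prob_space M using V by (rule brownian_motion_prob_space)
  define S where "S = obs_info H \<Gamma>"
  define c where "c = noise_constant H \<Gamma> \<Gamma>h h T"
  define JK where "JK = mean_residual A S f PK mK"
  define JD where "JD = mean_residual A S f PD mD"
  define b where "b = norm A + p * norm S + norm S"
  have c: "0 \<le> c" using \<open>0 \<le> T\<close> by (simp add: c_def noise_constant_def)
  have \<eta>0: "0 \<le> \<eta>" using order_trans[OF norm_ge_zero \<eta>[of 0]] \<open>0 \<le> T\<close> by simp
  have p0: "0 \<le> p" using order_trans[OF norm_ge_zero p(1)[of 0]] \<open>0 \<le> T\<close> by simp
  have b: "0 \<le> b" using p0 by (simp add: b_def)
  have "\<forall>t. \<exists>I. 0 \<le> t \<longrightarrow> ito_integral M (\<lambda>s. kalman_gain H \<Gamma> (PK s)) (observation H \<Gamma>h X V) t I \<and>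
      (AE \<omega> in M. JK t \<omega> = I \<omega>)"
    using mean_residual_ito[OF mK] unfolding JK_def S_def by metis
  then obtain IK where IK: "\<And>t. 0 \<le> t \<Longrightarrow> ito_integral M (\<lambda>s. kalman_gain H \<Gamma> (PK s)) (observation H \<Gamma>h X V) t (IK t)"
    "\<And>t. 0 \<le> t \<Longrightarrow> AE \<omega> in M. JK t \<omega> = IK t \<omega>" by metis
  have "\<forall>t. \<exists>I. 0 \<le> t \<longrightarrow> ito_integral M (\<lambda>s. kalman_gain H \<Gamma> (PD s)) (observation H \<Gamma>h X V) t I \<and>
      (AE \<omega> in M. JD t \<omega> = I \<omega>)"
    using mean_residual_ito[OF mD] unfolding JD_def S_def by metis
  then obtain ID where ID: "\<And>t. 0 \<le> t \<Longrightarrow> ito_integral M (\<lambda>s. kalman_gain H \<Gamma> (PD s)) (observation H \<Gamma>h X V) t (ID t)"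
    "\<And>t. 0 \<le> t \<Longrightarrow> AE \<omega> in M. JD t \<omega> = ID t \<omega>" by metis
  \<comment> \<open>The gain is linear in the covariance, so the noise of the difference has the gain of \<open>PD - PK\<close>.\<close>
  have IDK: "ito_integral M (\<lambda>s. kalman_gain H \<Gamma> (PD s - PK s)) (observation H \<Gamma>h X V) t (\<lambda>\<omega>. ID t \<omega> - IK t \<omega>)"
    if "0 \<le> t" for t
    using ito_integral_diff[OF ID(1)[OF that] IK(1)[OF that] observation_measurable[OF V]]
    by (simp add: kalman_gain_def matrix_mult_diff_left)
  have [measurable]: "mK t \<in> borel_measurable M" "mD t \<in> borel_measurable M" if "0 \<le> t" for t
    using mK mD that by (simp_all add: mean_solution_def)
  have path: "AE \<omega> in M. continuous_on {0..T} (\<lambda>t. mK t \<omega>)" "AE \<omega> in M. continuous_on {0..T} (\<lambda>t. mD t \<omega>)"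
    using mK mD by (auto intro: mean_solution_continuous)
  define v where "v t \<omega> = norm (mD t \<omega> - mK t \<omega>) + \<eta> * norm (mK t \<omega>)" for t \<omega>
  define a where "a t \<omega> = norm (mD 0 \<omega> - mK 0 \<omega>) + norm (JD t \<omega> - JK t \<omega>) +
      \<eta> * norm (mK 0 \<omega>) + \<eta> * (norm f * T) + \<eta> * norm (JK t \<omega>)" for t \<omega>
  define g where "g t \<omega> = norm (mD 0 \<omega> - mK 0 \<omega>) + norm (ID t \<omega> - IK t \<omega>) +
      \<eta> * norm (mK 0 \<omega>) + \<eta> * (norm f * T) + \<eta> * norm (IK t \<omega>)" for t \<omega>
  define K where "K = 5 * D + 5 * (c * \<eta>\<^sup>2) + 5 * (\<eta>\<^sup>2 * \<rho>) + 5 * (\<eta> * (norm f * T))\<^sup>2 + 5 * (\<eta>\<^sup>2 * (c * p\<^sup>2))"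
  have K: "0 \<le> K" using c \<open>0 \<le> D\<close> \<open>0 \<le> \<rho>\<close> by (simp add: K_def)
  have moment: "(\<integral>\<^sup>+\<omega>. ennreal ((g t \<omega>)\<^sup>2) \<partial>M) \<le> ennreal K" if t: "t \<in> {0..T}" for t
  proof -
    have t0: "0 \<le> t" using t by simp
    note [measurable] = ito_integral_measurable[OF IK(1)[OF t0]] ito_integral_measurable[OF ID(1)[OF t0]]
    have le: "ennreal ((g t \<omega>)\<^sup>2) \<le> 5 * ennreal ((norm (mD 0 \<omega> - mK 0 \<omega>))\<^sup>2) + 5 * ennreal ((norm (ID t \<omega> - IK t \<omega>))\<^sup>2) +
      ennreal (5 * \<eta>\<^sup>2) * ennreal ((norm (mK 0 \<omega>))\<^sup>2) + ennreal (5 * (\<eta> * (norm f * T))\<^sup>2) + 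
      ennreal (5 * \<eta>\<^sup>2) * ennreal ((norm (IK t \<omega>))\<^sup>2)" for \<omega>
      using power2_sum5_le[of "norm (mD 0 \<omega> - mK 0 \<omega>)" "norm (ID t \<omega> - IK t \<omega>)" "\<eta> * norm (mK 0 \<omega>)" "\<eta> * (norm f * T)" "\<eta> * norm (IK t \<omega>)"]
      by (simp add: g_def power_mult_distrib mult.assoc ennreal_leI flip: ennreal_plus ennreal_mult ennreal_numeral)
    have "(\<integral>\<^sup>+\<omega>. ennreal ((g t \<omega>)\<^sup>2) \<partial>M) \<le> 
      5 * (\<integral>\<^sup>+\<omega>. ennreal ((norm (mD 0 \<omega> - mK 0 \<omega>))\<^sup>2) \<partial>M) + 5 * (\<integral>\<^sup>+\<omega>. ennreal ((norm (ID t \<omega> - IK t \<omega>))\<^sup>2) \<partial>M) +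
      ennreal (5 * \<eta>\<^sup>2) * (\<integral>\<^sup>+\<omega>. ennreal ((norm (mK 0 \<omega>))\<^sup>2) \<partial>M) + ennreal (5 * (\<eta> * (norm f * T))\<^sup>2) + 
      ennreal (5 * \<eta>\<^sup>2) * (\<integral>\<^sup>+\<omega>. ennreal ((norm (IK t \<omega>))\<^sup>2) \<partial>M)"
      by (rule order_trans[OF nn_integral_mono[OF le]]) (simp add: nn_integral_add nn_integral_cmult emeasure_space_1)
    also have "\<dots> \<le> 5 * ennreal D + 5 * ennreal (c * \<eta>\<^sup>2) + ennreal (5 * \<eta>\<^sup>2) * ennreal \<rho> + 
        ennreal (5 * (\<eta> * (norm f * T))\<^sup>2) + ennreal (5 * \<eta>\<^sup>2) * ennreal (c * p\<^sup>2)"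
      unfolding c_def
      by (intro add_mono mult_left_mono D \<rho> order_refl kalman_noise_second_moment[OF V X IK(1)[OF t0] t p(1) h]
          kalman_noise_second_moment[OF V X IDK[OF t0] t \<eta> h]) auto
    also have "\<dots> = ennreal K"
      using c \<open>0 \<le> D\<close> \<open>0 \<le> \<rho>\<close>
      by (simp add: K_def mult.assoc flip: ennreal_plus ennreal_mult ennreal_numeral)
    finally show ?thesis .
  qed
  have "(\<integral>\<^sup>+\<omega>. ennreal ((v T \<omega>)\<^sup>2) \<partial>M) \<le> ennreal (2 * (1 + (b * exp (b * T) * T)\<^sup>2) * K)"
  proof (rule moment_gronwall[where a = a and g = g])
    show "AE \<omega> in M. continuous_on {0..T} (\<lambda>t. v t \<omega>)"
      using path by eventually_elim (auto simp: v_def intro!: continuous_intros)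
    show "AE \<omega> in M. continuous_on {0..T} (\<lambda>t. a t \<omega>)"
      using path
    proof eventually_elim
      case (elim \<omega>)
      show ?case unfolding a_def JK_def JD_def
        by (intro continuous_intros continuous_on_mean_residual P elim)
    qed
    show "AE \<omega> in M. \<forall>t\<in>{0..T}. 0 \<le> v t \<omega> \<and> 0 \<le> a t \<omega>"
      using \<eta>0 \<open>0 \<le> T\<close> by (auto simp: v_def a_def)
    show "AE \<omega> in M. \<forall>t\<in>{0..T}. v t \<omega> \<le> a t \<omega> + b * integral {0..t} (\<lambda>s. v s \<omega>)"
      using path
    proof eventually_elim
      case (elim \<omega>)
      show ?case unfolding v_def a_def b_def JK_def JD_def
        by (intro ballI mean_difference_growth[where mK = mK and mD = mD and \<omega> = \<omega>] P elim p \<eta>)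
    qed
    show "g t \<in> borel_measurable M" if "t \<in> {0..T}" for t
    proof -
      have t0: "0 \<le> t" using that by simp
      note [measurable] = ito_integral_measurable[OF IK(1)[OF t0]] ito_integral_measurable[OF ID(1)[OF t0]]
      show ?thesis unfolding g_def[abs_def] by measurable
    qed
    show "AE \<omega> in M. a t \<omega> = g t \<omega>" if "t \<in> {0..T}" for t
    proof -
      have "0 \<le> t" using that by simp
      from IK(2)[OF this] ID(2)[OF this] show ?thesis by eventually_elim (simp add: a_def g_def)
    qed
  qed (use b K moment \<open>0 \<le> T\<close> in auto)
  also have "\<dots> \<le> ennreal (mean_constant A S f c p \<rho> T * (D + \<eta>\<^sup>2))"
  proof (rule ennreal_leI)
    have "K \<le> 5 * (1 + c + \<rho> + (norm f * T)\<^sup>2 + c * p\<^sup>2) * (D + \<eta>\<^sup>2)"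
    proof -
      have "0 \<le> 5 * (c + \<rho> + (norm f * T)\<^sup>2 + c * p\<^sup>2) * D + 5 * \<eta>\<^sup>2"
        using c \<open>0 \<le> D\<close> \<open>0 \<le> \<rho>\<close> by (intro add_nonneg_nonneg mult_nonneg_nonneg) auto
      then show ?thesis by (simp add: K_def power_mult_distrib algebra_simps)
    qed
    then have "2 * (1 + (b * exp (b * T) * T)\<^sup>2) * K \<le>
       2 * (1 + (b * exp (b * T) * T)\<^sup>2) * (5 * (1 + c + \<rho> + (norm f * T)\<^sup>2 + c * p\<^sup>2) * (D + \<eta>\<^sup>2))"
      by (intro mult_left_mono) auto
    then show "2 * (1 + (b * exp (b * T) * T)\<^sup>2) * K \<le> mean_constant A S f c p \<rho> T * (D + \<eta>\<^sup>2)"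
      by (simp only: mean_constant_def Let_def b_def mult.assoc)
  qed
  finally have "(\<integral>\<^sup>+\<omega>. ennreal ((v T \<omega>)\<^sup>2) \<partial>M) \<le> ennreal (mean_constant A S f c p \<rho> T * (D + \<eta>\<^sup>2))" .
  moreover have "(\<integral>\<^sup>+\<omega>. ennreal ((norm (mD T \<omega> - mK T \<omega>))\<^sup>2) \<partial>M) \<le> (\<integral>\<^sup>+\<omega>. ennreal ((v T \<omega>)\<^sup>2) \<partial>M)"
    using \<eta>0 by (intro nn_integral_mono ennreal_leI power_mono) (auto simp: v_def)
  ultimately show ?thesis by (simp add: S_def c_def)
qed

section \<open>The projected noise and the final estimate\<close>

lemma proj_noise_psd:
  "sym_psd \<Sigma> \<Longrightarrow> sym_psd (proj U ** \<Sigma> ** proj U)"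
  using sym_psd_congruence[of \<Sigma> "proj U"] by simp

lemma proj_noise_bound:
  fixes U :: "real ^ 'r ^ 'd"
  assumes "U \<in> stiefel"
  shows "norm (proj U ** \<Sigma> ** proj U) \<le> (real CARD('r))\<^sup>2 * norm \<Sigma>"
proof -
  have "norm (proj U ** \<Sigma> ** proj U) \<le> norm (proj U) * norm \<Sigma> * norm (proj U)"
    by (rule norm_triple_product_le)
  also have "\<dots> \<le> real CARD('r) * norm \<Sigma> * real CARD('r)"
    by (intro mult_mono norm_proj_stiefel assms) auto
  finally show ?thesis by (simp add: power2_eq_square mult_ac)
qed

text \<open>From \<open>\<Pi> = I - \<Pi>\<^sup>\<bottom>\<close>, \<open>\<Pi> \<Sigma> \<Pi> - \<Sigma> = - \<Pi>\<^sup>\<bottom> \<Sigma> - \<Pi> \<Sigma> \<Pi>\<^sup>\<bottom>\<close>; in either term \<open>\<Pi>\<^sup>\<bottom>\<close> stands next to a factor \<open>\<Sigma>\<^sup>1\<^sup>/\<^sup>2\<close>.\<close>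
lemma proj_noise_defect:
  fixes U :: "real ^ 'r ^ 'd"
  assumes U: "U \<in> stiefel" and sqrt: "is_sqrt \<Sigma>h \<Sigma>"
  shows "norm (proj U ** \<Sigma> ** proj U - \<Sigma>) \<le> (1 + real CARD('r)) * norm \<Sigma>h * noise_defect \<Sigma>h U"
proof -
  have \<Sigma>: "\<Sigma> = \<Sigma>h ** \<Sigma>h" "transpose \<Sigma>h = \<Sigma>h"
    using sqrt by (auto simp: is_sqrt_def sym_psd_def)
  have "proj U ** \<Sigma> ** proj U - \<Sigma> = - (proj_perp U ** \<Sigma>h ** \<Sigma>h) - proj U ** (\<Sigma>h ** (\<Sigma>h ** proj_perp U))"
    by (simp add: \<Sigma>(1) proj_perp_def matrix_mult_diff_left matrix_mult_diff_right matrix_mul_assoc)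
  moreover have "norm (proj_perp U ** \<Sigma>h ** \<Sigma>h) \<le> noise_defect \<Sigma>h U * norm \<Sigma>h"
    unfolding noise_defect_def by (rule norm_matrix_matrix_mult_le)
  moreover have "norm (proj U ** (\<Sigma>h ** (\<Sigma>h ** proj_perp U))) \<le> real CARD('r) * (norm \<Sigma>h * noise_defect \<Sigma>h U)"
  proof -
    have "\<Sigma>h ** proj_perp U = transpose (proj_perp U ** \<Sigma>h)" by (simp add: matrix_transpose_mul \<Sigma>(2))
    then have "norm (\<Sigma>h ** proj_perp U) = noise_defect \<Sigma>h U" by (simp add: noise_defect_def)
    then have inner: "norm (\<Sigma>h ** (\<Sigma>h ** proj_perp U)) \<le> norm \<Sigma>h * noise_defect \<Sigma>h U"
      by (metis norm_matrix_matrix_mult_le)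
    have "norm (proj U ** (\<Sigma>h ** (\<Sigma>h ** proj_perp U))) \<le> norm (proj U) * norm (\<Sigma>h ** (\<Sigma>h ** proj_perp U))"
      by (rule norm_matrix_matrix_mult_le)
    also have "\<dots> \<le> real CARD('r) * (norm \<Sigma>h * noise_defect \<Sigma>h U)"
      by (intro mult_mono norm_proj_stiefel[OF U] inner) auto
    finally show ?thesis .
  qed
  ultimately have "norm (proj U ** \<Sigma> ** proj U - \<Sigma>) \<le>
      noise_defect \<Sigma>h U * norm \<Sigma>h + real CARD('r) * (norm \<Sigma>h * noise_defect \<Sigma>h U)"
    using norm_triangle_ineq4[of "- (proj_perp U ** \<Sigma>h ** \<Sigma>h)" "proj U ** (\<Sigma>h ** (\<Sigma>h ** proj_perp U))"] by simp
  then show ?thesis by (simp add: algebra_simps)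
qed

text \<open>Makes the supremum of the squared defect over a compact time interval a genuine upper bound.\<close>
lemma noise_defect_bound:
  fixes U :: "real ^ 'r ^ 'd"
  assumes "U \<in> stiefel"
  shows "noise_defect \<Sigma>h U \<le> (norm (mat 1 :: real ^ 'd ^ 'd) + real CARD('r)) * norm \<Sigma>h"
proof -
  have "norm (proj_perp U) \<le> norm (mat 1 :: real ^ 'd ^ 'd) + real CARD('r)"
    unfolding proj_perp_def using norm_triangle_ineq4[of "mat 1" "proj U"] norm_proj_stiefel[OF assms] by linarith
  then show ?thesis
    unfolding noise_defect_def by (intro order_trans[OF norm_matrix_matrix_mult_le] mult_right_mono) auto
qed

lemma nn_integral_norm_diff_eq:
  fixes Y W :: "'w \<Rightarrow> 'a::euclidean_space"
  assumes [measurable]: "Y \<in> borel_measurable M" "W \<in> borel_measurable M"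
    and "integrable M (\<lambda>\<omega>. (norm (Y \<omega>))\<^sup>2)" "integrable M (\<lambda>\<omega>. (norm (W \<omega>))\<^sup>2)"
  shows "(\<integral>\<^sup>+\<omega>. ennreal ((norm (Y \<omega> - W \<omega>))\<^sup>2) \<partial>M) = ennreal (\<integral>\<omega>. (norm (Y \<omega> - W \<omega>))\<^sup>2 \<partial>M)"
proof (rule nn_integral_eq_integral)
  have le: "(norm (Y \<omega> - W \<omega>))\<^sup>2 \<le> 2 * (norm (Y \<omega>))\<^sup>2 + 2 * (norm (W \<omega>))\<^sup>2" for \<omega>
    using power2_norm_add_le[of "Y \<omega>" "- W \<omega>"] by simp
  show "integrable M (\<lambda>\<omega>. (norm (Y \<omega> - W \<omega>))\<^sup>2)"
  proof (rule Bochner_Integration.integrable_bound)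
    show "integrable M (\<lambda>\<omega>. 2 * (norm (Y \<omega>))\<^sup>2 + 2 * (norm (W \<omega>))\<^sup>2)" using assms by simp
    show "AE \<omega> in M. norm ((norm (Y \<omega> - W \<omega>))\<^sup>2) \<le> norm (2 * (norm (Y \<omega>))\<^sup>2 + 2 * (norm (W \<omega>))\<^sup>2)"
      using le by (intro AE_I2) (simp add: abs_of_nonneg)
  qed measurable
qed simp

theorem proposition4p4:
  fixes A \<Sigma> \<Sigma>h :: "real ^ 'd ^ 'd"
    and f :: "real ^ 'd"
    and H :: "real ^ 'd ^ 'k"
    and \<Gamma> \<Gamma>h :: "real ^ 'k ^ 'k"
    and X :: "real \<Rightarrow> real ^ 'd"
    and \<rho> :: real
  assumes "CARD('r) \<le> CARD('d)"
    and "sym_psd \<Sigma>" and "is_sqrt \<Sigma>h \<Sigma>"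
    and "sym_pd \<Gamma>" and "is_sqrt \<Gamma>h \<Gamma>"
    and "continuous_on {0..} X"
  shows "\<exists>C1 C2 :: real \<Rightarrow> real.
    \<forall>(U :: real \<Rightarrow> real ^ 'r ^ 'd) (M0 :: real ^ 'r ^ 'r) (PK :: real \<Rightarrow> real ^ 'd ^ 'd) PD T.
      basis_solution A U \<and>
      riccati_solution A (obs_info H \<Gamma>) (\<lambda>_. \<Sigma>) PK \<and>
      riccati_solution A (obs_info H \<Gamma>) (\<lambda>t. proj (U t) ** \<Sigma> ** proj (U t)) PD \<and>
      sym_psd (PK 0) \<and>
      sym_psd M0 \<and> PD 0 = U 0 ** M0 ** transpose (U 0) \<and>
      norm (PK 0) \<le> \<rho> \<and> norm (PD 0) \<le> \<rho> \<and>
      0 \<le> T \<longrightarrow>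
      (\<forall>(M :: 'w measure) (V :: real \<Rightarrow> 'w \<Rightarrow> real ^ 'k) mK mD.
         brownian_motion M V \<and>
         mean_solution M A f H \<Gamma> (observation H \<Gamma>h X V) PK mK \<and>
         mean_solution M A f H \<Gamma> (observation H \<Gamma>h X V) PD mD \<and>
         integrable M (\<lambda>\<omega>. (norm (mK 0 \<omega>))\<^sup>2) \<and> indep_of_process M (mK 0) V \<and>
         integrable M (\<lambda>\<omega>. (norm (mD 0 \<omega>))\<^sup>2) \<and> indep_of_process M (mD 0) V \<and>
         (\<integral>\<omega>. (norm (mK 0 \<omega>))\<^sup>2 \<partial>M) \<le> \<rho> \<longrightarrow>
         integrable M (\<lambda>\<omega>. (norm (mD T \<omega> - mK T \<omega>))\<^sup>2) \<and>
         (\<integral>\<omega>. (norm (mD T \<omega> - mK T \<omega>))\<^sup>2 \<partial>M)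
           \<le> C1 T * ((\<integral>\<omega>. (norm (mD 0 \<omega> - mK 0 \<omega>))\<^sup>2 \<partial>M) + (norm (PK 0 - PD 0))\<^sup>2
                     + (SUP s\<in>{0..T}. (noise_defect \<Sigma>h (U s))\<^sup>2))) \<and>
      (norm (PD T - PK T))\<^sup>2
        \<le> C2 T * ((norm (PD 0 - PK 0))\<^sup>2 + (SUP s\<in>{0..T}. (noise_defect \<Sigma>h (U s))\<^sup>2))"
proof -
  define S where "S = obs_info H \<Gamma>"
  define R where "R = real CARD('r)"
  \<comment> \<open>Bounds both inhomogeneities \<open>\<Sigma>\<close> and \<open>\<Pi> \<Sigma> \<Pi>\<close>.\<close>
  define q where "q = (1 + R\<^sup>2) * norm \<Sigma>"
  define p where "p T = riccati_bound A q \<rho> T" for T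
  define C2 where "C2 T = exp ((2 * (2 * norm A + 2 * p T * norm S) + 1) * T) *
    (1 + T * ((1 + R) * norm \<Sigma>h)\<^sup>2)" for T
  have "\<exists>B. \<forall>s\<in>{0..T}. norm (H *v X s) \<le> B" for T
  proof -
    have "continuous_on {0..T} (\<lambda>s. H *v X s)"
      by (intro continuous_on_matrix_vector_mult continuous_on_const continuous_on_subset[OF assms(6)]) auto
    then show ?thesis by (rule compact_interval_norm_bound) blast
  qed
  then obtain h where h: "\<And>T s. s \<in> {0..T} \<Longrightarrow> norm (H *v X s) \<le> h T" by metis
  define C1 where "C1 T = mean_constant A S f (noise_constant H \<Gamma> \<Gamma>h (h T) T) (p T) \<rho> T * (1 + C2 T)" for T
  have S: "sym_psd S" unfolding S_def using assms(4) by (rule sym_psd_obs_info)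
  have R: "0 \<le> R" by (simp add: R_def)
  have q0: "0 \<le> q" by (simp add: q_def)
  show ?thesis
  proof (rule exI[of _ C1], rule exI[of _ C2], intro allI impI, (erule conjE)+)
    fix U :: "real \<Rightarrow> real ^ 'r ^ 'd" and M0 :: "real ^ 'r ^ 'r" and PK PD :: "real \<Rightarrow> real ^ 'd ^ 'd" and T :: real
    assume U: "basis_solution A U"
      and "riccati_solution A (obs_info H \<Gamma>) (\<lambda>_. \<Sigma>) PK"
      and "riccati_solution A (obs_info H \<Gamma>) (\<lambda>t. proj (U t) ** \<Sigma> ** proj (U t)) PD"
      and PK0: "sym_psd (PK 0)" and M0: "sym_psd M0" and PD0: "PD 0 = U 0 ** M0 ** transpose (U 0)"
      and \<rho>: "norm (PK 0) \<le> \<rho>" "norm (PD 0) \<le> \<rho>" and T: "0 \<le> T"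
    then have PK: "riccati_solution A S (\<lambda>_. \<Sigma>) PK"
      and PD: "riccati_solution A S (\<lambda>t. proj (U t) ** \<Sigma> ** proj (U t)) PD" by (simp_all add: S_def)
    have \<rho>0: "0 \<le> \<rho>" using order_trans[OF norm_ge_zero \<rho>(1)] .
    have stiefel: "U t \<in> stiefel" if "0 \<le> t" for t using basis_solution_stiefel[OF U that] .
    have PD0_psd: "sym_psd (PD 0)" unfolding PD0 by (rule sym_psd_congruence[OF M0])
    have p: "norm (PK s) \<le> p T" "norm (PD s) \<le> p T" if s: "s \<in> {0..T}" for s
    proof -
      have s0: "0 \<le> s" using s by simp
      have "norm (PK s) \<le> riccati_bound A q \<rho> s"
        by (rule riccati_norm_bound[OF PK S assms(2) PK0 s0 _ \<rho>(1)]) (simp add: q_def distrib_right)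
      moreover have "norm (PD s) \<le> riccati_bound A q \<rho> s"
      proof (rule riccati_norm_bound[OF PD S proj_noise_psd[OF assms(2)] PD0_psd s0 _ \<rho>(2)])
        fix t :: real assume "0 \<le> t"
        from proj_noise_bound[OF stiefel[OF this], of \<Sigma>]
        show "norm (proj (U t) ** \<Sigma> ** proj (U t)) \<le> q"
          by (simp add: q_def R_def distrib_right add_increasing)
      qed
      moreover have "riccati_bound A q \<rho> s \<le> p T"
        unfolding p_def using s by (intro riccati_bound_mono q0 \<rho>0) auto
      ultimately show "norm (PK s) \<le> p T" "norm (PD s) \<le> p T" by linarith+
    qed
    have p0: "0 \<le> p T" using order_trans[OF norm_ge_zero p(1)[of 0]] T by simp
    define \<epsilon> where "\<epsilon> = (SUP s\<in>{0..T}. (noise_defect \<Sigma>h (U s))\<^sup>2)"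
    define E0 where "E0 = (norm (PD 0 - PK 0))\<^sup>2"
    have bdd: "bdd_above ((\<lambda>s. (noise_defect \<Sigma>h (U s))\<^sup>2) ` {0..T})"
    proof (rule bdd_aboveI2)
      fix s assume "s \<in> {0..T}"
      then show "(noise_defect \<Sigma>h (U s))\<^sup>2 \<le> ((norm (mat 1 :: real ^ 'd ^ 'd) + R) * norm \<Sigma>h)\<^sup>2"
        unfolding R_def by (intro power_mono noise_defect_bound stiefel) (auto simp: noise_defect_def)
    qed
    have \<epsilon>_upper: "(noise_defect \<Sigma>h (U s))\<^sup>2 \<le> \<epsilon>" if "s \<in> {0..T}" for s
      unfolding \<epsilon>_def by (rule cSUP_upper[OF that bdd])
    have \<epsilon>0: "0 \<le> \<epsilon>" using order_trans[OF zero_le_power2 \<epsilon>_upper[of 0]] T by simp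
    have cov: "(norm (PD s - PK s))\<^sup>2 \<le> C2 T * (E0 + \<epsilon>)" if s: "s \<in> {0..T}" for s
    proof -
      define L where "L = 2 * (2 * norm A + 2 * p T * norm S) + 1"
      have L: "0 \<le> L" using p0 by (simp add: L_def)
      \<comment> \<open>The stability estimate needs a forcing bound that is constant in time, hence the supremum.\<close>
      define c where "c = (1 + R) * norm \<Sigma>h * sqrt \<epsilon>"
      define \<kappa> where "\<kappa> = ((1 + R) * norm \<Sigma>h)\<^sup>2"
      have "(norm (PD s - PK s))\<^sup>2 \<le> exp (L * s) * ((norm (PD 0 - PK 0))\<^sup>2 + s * c\<^sup>2)"
        unfolding L_def
      proof (rule riccati_stability[OF PD PK])
        fix t assume "t \<in> {0..s}"
        then have t: "t \<in> {0..T}" using s by auto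
        then show "norm (PD t) \<le> p T" "norm (PK t) \<le> p T" using p by auto
        have "norm (proj (U t) ** \<Sigma> ** proj (U t) - \<Sigma>) \<le> (1 + R) * norm \<Sigma>h * noise_defect \<Sigma>h (U t)"
          unfolding R_def using t by (intro proj_noise_defect[OF stiefel assms(3)]) auto
        also have "\<dots> \<le> c" unfolding c_def
          using \<epsilon>_upper[OF t] R by (intro mult_left_mono) (auto simp: real_le_rsqrt)
        finally show "norm (proj (U t) ** \<Sigma> ** proj (U t) - \<Sigma>) \<le> c" .
      qed (use s in auto)
      also have "\<dots> \<le> exp (L * T) * (E0 + T * c\<^sup>2)"
        unfolding E0_def using s L by (intro mult_mono add_mono mult_right_mono) (auto intro!: mult_left_mono)
      also have "\<dots> \<le> exp (L * T) * ((1 + T * \<kappa>) * (E0 + \<epsilon>))"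
      proof (intro mult_left_mono)
        have "0 \<le> \<epsilon> + T * \<kappa> * E0" using \<epsilon>0 T by (simp add: E0_def \<kappa>_def)
        moreover have "c\<^sup>2 = \<kappa> * \<epsilon>" using \<epsilon>0 by (simp add: c_def \<kappa>_def power_mult_distrib)
        ultimately show "E0 + T * c\<^sup>2 \<le> (1 + T * \<kappa>) * (E0 + \<epsilon>)" by (simp add: algebra_simps)
      qed simp
      finally show ?thesis by (simp only: C2_def L_def \<kappa>_def mult.assoc)
    qed
    have "0 \<le> C2 T" using T by (simp add: C2_def)
    show "(\<forall>(M :: 'w measure) (V :: real \<Rightarrow> 'w \<Rightarrow> real ^ 'k) mK mD.
         brownian_motion M V \<and>
         mean_solution M A f H \<Gamma> (observation H \<Gamma>h X V) PK mK \<and>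
         mean_solution M A f H \<Gamma> (observation H \<Gamma>h X V) PD mD \<and>
         integrable M (\<lambda>\<omega>. (norm (mK 0 \<omega>))\<^sup>2) \<and> indep_of_process M (mK 0) V \<and>
         integrable M (\<lambda>\<omega>. (norm (mD 0 \<omega>))\<^sup>2) \<and> indep_of_process M (mD 0) V \<and>
         (\<integral>\<omega>. (norm (mK 0 \<omega>))\<^sup>2 \<partial>M) \<le> \<rho> \<longrightarrow>
         integrable M (\<lambda>\<omega>. (norm (mD T \<omega> - mK T \<omega>))\<^sup>2) \<and>
         (\<integral>\<omega>. (norm (mD T \<omega> - mK T \<omega>))\<^sup>2 \<partial>M)
           \<le> C1 T * ((\<integral>\<omega>. (norm (mD 0 \<omega> - mK 0 \<omega>))\<^sup>2 \<partial>M) + (norm (PK 0 - PD 0))\<^sup>2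
                     + (SUP s\<in>{0..T}. (noise_defect \<Sigma>h (U s))\<^sup>2))) \<and>
      (norm (PD T - PK T))\<^sup>2
        \<le> C2 T * ((norm (PD 0 - PK 0))\<^sup>2 + (SUP s\<in>{0..T}. (noise_defect \<Sigma>h (U s))\<^sup>2))"
    proof (rule conjI, intro allI impI, (erule conjE)+)
      show "(norm (PD T - PK T))\<^sup>2 \<le> C2 T * ((norm (PD 0 - PK 0))\<^sup>2 + (SUP s\<in>{0..T}. (noise_defect \<Sigma>h (U s))\<^sup>2))"
        using cov[of T] T by (simp add: E0_def \<epsilon>_def)
      fix M :: "'w measure" and V :: "real \<Rightarrow> 'w \<Rightarrow> real ^ 'k" and mK mD
      assume V: "brownian_motion M V"
        and mK: "mean_solution M A f H \<Gamma> (observation H \<Gamma>h X V) PK mK"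
        and mD: "mean_solution M A f H \<Gamma> (observation H \<Gamma>h X V) PD mD"
        and sq: "integrable M (\<lambda>\<omega>. (norm (mK 0 \<omega>))\<^sup>2)" "integrable M (\<lambda>\<omega>. (norm (mD 0 \<omega>))\<^sup>2)"
        and mK0: "(\<integral>\<omega>. (norm (mK 0 \<omega>))\<^sup>2 \<partial>M) \<le> \<rho>"
      have meas [measurable]: "mK t \<in> borel_measurable M" "mD t \<in> borel_measurable M" if "0 \<le> t" for t
        using mK mD that by (simp_all add: mean_solution_def)
      define D where "D = (\<integral>\<omega>. (norm (mD 0 \<omega> - mK 0 \<omega>))\<^sup>2 \<partial>M)"
      \<comment> \<open>By the covariance estimate up to time \<open>T\<close>, a uniform bound for the covariance difference.\<close>
      define \<eta> where "\<eta> = sqrt (C2 T * (E0 + \<epsilon>))"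
      define C where "C = mean_constant A S f (noise_constant H \<Gamma> \<Gamma>h (h T) T) (p T) \<rho> T"
      have D: "0 \<le> D" by (simp add: D_def)
      have E0: "0 \<le> E0" by (simp add: E0_def)
      have \<eta>2: "\<eta>\<^sup>2 = C2 T * (E0 + \<epsilon>)" using \<open>0 \<le> C2 T\<close> E0 \<epsilon>0 by (simp add: \<eta>_def)
      have noise0: "0 \<le> noise_constant H \<Gamma> \<Gamma>h (h T) T" using T by (simp add: noise_constant_def)
      have C: "0 \<le> C" unfolding C_def mean_constant_def Let_def using noise0 \<rho>0
        by (intro mult_nonneg_nonneg add_nonneg_nonneg) auto
      have "(\<integral>\<^sup>+\<omega>. ennreal ((norm (mD T \<omega> - mK T \<omega>))\<^sup>2) \<partial>M) \<le> ennreal (C * (D + \<eta>\<^sup>2))"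
        unfolding C_def S_def
      proof (rule mean_difference_second_moment[OF V assms(6) mK mD])
        show "continuous_on {0..T} PK" "continuous_on {0..T} PD"
          using riccati_solution_continuous PK PD by blast+
        show "norm (PD t - PK t) \<le> \<eta>" if "t \<in> {0..T}" for t
          unfolding \<eta>_def by (rule real_le_rsqrt[OF cov[OF that]])
        show "(\<integral>\<^sup>+\<omega>. ennreal ((norm (mD 0 \<omega> - mK 0 \<omega>))\<^sup>2) \<partial>M) \<le> ennreal D"
          unfolding D_def by (subst nn_integral_norm_diff_eq) (auto simp: meas sq)
        show "(\<integral>\<^sup>+\<omega>. ennreal ((norm (mK 0 \<omega>))\<^sup>2) \<partial>M) \<le> ennreal \<rho>"
          using mK0 by (subst nn_integral_eq_integral) (auto simp: sq ennreal_leI)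
      qed (use p h T D \<rho>0 in auto)
      also have "\<dots> \<le> ennreal (C1 T * (D + E0 + \<epsilon>))"
      proof (rule ennreal_leI)
        have "D + \<eta>\<^sup>2 \<le> (1 + C2 T) * (D + E0 + \<epsilon>)"
        proof -
          have "0 \<le> E0 + \<epsilon> + C2 T * D" using E0 \<epsilon>0 D \<open>0 \<le> C2 T\<close> by simp
          then show ?thesis by (simp add: \<eta>2 algebra_simps)
        qed
        then have "C * (D + \<eta>\<^sup>2) \<le> C * ((1 + C2 T) * (D + E0 + \<epsilon>))" using C by (rule mult_left_mono)
        then show "C * (D + \<eta>\<^sup>2) \<le> C1 T * (D + E0 + \<epsilon>)" by (simp only: C1_def C_def mult.assoc)
      qed
      finally have bound: "(\<integral>\<^sup>+\<omega>. ennreal ((norm (mD T \<omega> - mK T \<omega>))\<^sup>2) \<partial>M) \<le> ennreal (C1 T * (D + E0 + \<epsilon>))" .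
      have nonneg: "0 \<le> C1 T * (D + E0 + \<epsilon>)"
        using C \<open>0 \<le> C2 T\<close> D E0 \<epsilon>0 by (simp add: C1_def flip: C_def)
      have int: "integrable M (\<lambda>\<omega>. (norm (mD T \<omega> - mK T \<omega>))\<^sup>2)"
      proof (rule integrableI_bounded)
        show "(\<lambda>\<omega>. (norm (mD T \<omega> - mK T \<omega>))\<^sup>2) \<in> borel_measurable M"
          using meas[OF T] by measurable
        show "(\<integral>\<^sup>+\<omega>. ennreal (norm ((norm (mD T \<omega> - mK T \<omega>))\<^sup>2)) \<partial>M) < \<infinity>"
          using order_le_less_trans[OF bound ennreal_less_top] by simp
      qed
      moreover have "(\<integral>\<omega>. (norm (mD T \<omega> - mK T \<omega>))\<^sup>2 \<partial>M) \<le> C1 T * (D + E0 + \<epsilon>)"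
        using bound nonneg int by (simp add: nn_integral_eq_integral)
      ultimately show "integrable M (\<lambda>\<omega>. (norm (mD T \<omega> - mK T \<omega>))\<^sup>2) \<and>
         (\<integral>\<omega>. (norm (mD T \<omega> - mK T \<omega>))\<^sup>2 \<partial>M)
           \<le> C1 T * ((\<integral>\<omega>. (norm (mD 0 \<omega> - mK 0 \<omega>))\<^sup>2 \<partial>M) + (norm (PK 0 - PD 0))\<^sup>2
                     + (SUP s\<in>{0..T}. (noise_defect \<Sigma>h (U s))\<^sup>2))"
        by (simp add: D_def E0_def \<epsilon>_def norm_minus_commute)
    qed
  qed
qed

end
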